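(* Let $d,m\in\mathbb{N}$ and let $T_1,\ldots,T_m$ be invertible $d\times d$ real matrices with $\|T_i\|<1/2$ for $1\le i\le m$. Suppose that at least one of the following two conditions holds: (i) $\sum_{i=1}^m\alpha_d(T_i)^d\,|\det(T_i)|>1$; (ii) all $T_i$ are scalar multiples of orthogonal matrices, and $\sum_{i=1}^m|\det(T_i)|^2>1$. Then for $\mathcal{L}^{md}$-a.e. $\mathbf{a}=(a_1,\ldots,a_m)\in\mathbb{R}^{md}$, the self-affine set $K^{\mathbf{a}}$ generated by the iterated function system $\{T_ix+a_i\}_{i=1}^m$ on $\mathbb{R}^d$ has non-empty interior.
   Context: $\|\cdot\|$ is the operator norm induced by the Euclidean norm on $\mathbb{R}^d$. $\alpha_d(A)$ denotes the smallest singular value of a $d\times d$ real matrix $A$. For $\mathbf{a}=(a_1,\ldots,a_m)\in\mathbb{R}^{md}$ (each $a_i\in\mathbb{R}^d$), $K^{\mathbf{a}}$ is the unique non-empty compact set $K\subset\mathbb{R}^d$ with $K=\bigcup_{i=1}^m (T_iK+a_i)$. $\mathcal{L}^{md}$ is Lebesgue measure on $\mathbb{R}^{md}$. *)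

theory Defs
  imports "HOL-Analysis.Analysis"
begin

definition singular_values :: "real^'d^'d \<Rightarrow> real set" where
  "singular_values A =
     {sqrt l |l. \<exists>v. v \<noteq> 0 \<and> (transpose A ** A) *v v = l *\<^sub>R v}"

text \<open>
  As \<open>transpose A ** A\<close> is symmetric and positive semidefinite, \<open>singular_values A\<close>
  is a finite, non-empty set of non-negative numbers. Multiplicities play no role for its minimum.
\<close>

definition smallest_singular_value :: "real^'d^'d \<Rightarrow> real" where
  "smallest_singular_value A = Min (singular_values A)"

text \<open>
  \<open>THE\<close> is meaningful whenever every \<open>T i\<close> has Euclidean operator norm below 1: then exactly one
  such \<open>K\<close> exists (Hutchinson). The translation vector in \<open>\<real>\<^sup>m\<^sup>d\<close> is an element of
  \<open>(real^'d)^'m\<close>, whose \<open>i\<close>-th component is the vector \<open>a $ i\<close>.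
\<close>

definition self_affine_set :: "('m::finite \<Rightarrow> real^'d^'d) \<Rightarrow> (real^'d)^'m \<Rightarrow> (real^'d) set" where
  "self_affine_set T a =
     (THE K. K \<noteq> {} \<and> compact K \<and> K = (\<Union>i. (\<lambda>x. T i *v x + a $ i) ` K))"

end

theory Submission
  imports Defs "HOL-Probability.Characteristic_Functions" "HOL-Real_Asymp.Real_Asymp"
begin

text \<open>
  Condition (ii) is a special case of condition (i): if \<open>T\<^sub>i = c Q\<close> with \<open>Q\<close> orthogonal, then the
  smallest singular value \<open>\<alpha>\<^sub>i\<close> of \<open>T\<^sub>i\<close> is \<open>\<bar>c\<bar>\<close> and \<open>\<bar>det T\<^sub>i\<bar> = \<bar>c\<bar>\<^sup>d\<close>, so that both sums agree. It
  remains to treat condition (i).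

  Fix probability weights \<open>p\<^sub>i\<close>. The attractor for the translation vector \<open>a\<close> carries the self-affine
  measure with these weights. Let \<open>\<phi>\<^sub>a\<close> be its Fourier transform. If \<open>\<phi>\<^sub>a\<close> is integrable, then Fourier
  inversion provides a continuous density. The density is not identically zero and it vanishes off
  the attractor, so the set where it is non-zero is a non-empty open subset of the attractor
  (\<open>interior_nonempty_if_fourier_integrable\<close>). It is therefore enough that \<open>\<phi>\<^sub>a\<close> is integrable for almost
  every \<open>a\<close> (\<open>AE_integrable_limit_charfun\<close>).

  For this, average \<open>\<bar>\<phi>\<^sub>a(\<xi>)\<bar>\<^sup>2\<close> over a Gaussian vector \<open>a\<close>. The square is an average, over pairs of words
  \<open>I\<close>, \<open>J\<close>, of \<open>exp(i \<xi> \<bullet> (x\<^sub>I(a) - x\<^sub>J(a)))\<close>, where \<open>x\<^sub>I(a)\<close> is the point with code \<open>I\<close>. The difference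
  \<open>x\<^sub>I(a) - x\<^sub>J(a)\<close> is a linear function \<open>L a\<close>, so the Gaussian average is exactly
  \<open>exp(- \<bar>L\<^sup>* \<xi>\<bar>\<^sup>2 / 2)\<close>. Let \<open>u\<close> be the longest common prefix of \<open>I\<close> and \<open>J\<close> and \<open>T\<^sub>u\<close> the corresponding
  product of matrices. As all norms are below \<open>1/2\<close>, transversality holds: \<open>\<bar>L\<^sup>* \<xi>\<bar>\<close> is at least a
  constant times \<open>\<bar>T\<^sub>u\<^sup>t \<xi>\<bar>\<close> (\<open>overlap_distinct\<close>). Hence the mean of \<open>\<bar>\<phi>\<^sub>a(\<xi>)\<bar>\<^sup>2\<close> is at most a constant
  times the sum of \<open>p\<^sub>u\<^sup>2 exp(- \<kappa> \<bar>T\<^sub>u\<^sup>t \<xi>\<bar>\<^sup>2)\<close> over all words \<open>u\<close>.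

  Integrate this against the weight \<open>(1 + \<bar>\<xi>\<bar>\<^sup>2)\<^sup>s\<close>. The substitution \<open>\<eta> = T\<^sub>i\<^sup>t \<xi>\<close> costs the factor
  \<open>1 / \<bar>det T\<^sub>i\<bar>\<close>, and \<open>\<alpha>\<^sub>i \<bar>\<xi>\<bar> \<le> \<bar>\<eta>\<bar>\<close> costs another \<open>\<alpha>\<^sub>i\<close> to the power \<open>- 2 s\<close>. The sum over \<open>u\<close> becomes a
  geometric series whose ratio is the sum of \<open>p\<^sub>i\<^sup>2 / w\<^sub>i\<close>, where \<open>w\<^sub>i\<close> is \<open>\<bar>det T\<^sub>i\<bar>\<close> times \<open>\<alpha>\<^sub>i\<close> to the power
  \<open>2 s\<close> (\<open>weighted_energy_bound\<close>). The optimal weights are proportional to \<open>w\<^sub>i\<close> and give the ratio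
  \<open>1 / (\<Sum>\<^sub>i w\<^sub>i)\<close>. Since the inequality in (i) is strict, this ratio is below 1 for some \<open>s > d / 2\<close>. Then
  for almost every \<open>a\<close> the function \<open>(1 + \<bar>\<xi>\<bar>\<^sup>2)\<^sup>s \<bar>\<phi>\<^sub>a(\<xi>)\<bar>\<^sup>2\<close> is integrable, and as the reciprocal weight
  is integrable as well, so is \<open>\<phi>\<^sub>a\<close>.

  The self-affine measure itself never appears: it is replaced by the finitely supported measures on
  the points with codes of length \<open>n\<close>, whose Fourier transforms converge pointwise to \<open>\<phi>\<^sub>a\<close>.
\<close>

section \<open>The Fourier transform of Gaussian functions\<close>

lemma gaussian_fourier_real:
  fixes u t :: real
  assumes "0 < t"
  shows "has_bochner_integral lborel (\<lambda>x. cis (u * x) * of_real (exp (- t * x\<^sup>2 / 2)))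
           (of_real (sqrt (2 * pi / t) * exp (- u\<^sup>2 / (2 * t))))"
proof -
  have std: "has_bochner_integral lborel (\<lambda>x. std_normal_density x *\<^sub>R cis (v * x))
               (of_real (exp (- v\<^sup>2 / 2)))" for v :: real
  proof -
    interpret N: prob_space std_normal_distribution by (rule prob_space_normal_density) simp
    have [measurable]: "(\<lambda>x. cis (v * x)) \<in> borel_measurable borel"
      by (intro borel_measurable_continuous_onI continuous_intros)
    have int: "integrable std_normal_distribution (\<lambda>x. cis (v * x))"
      by (rule N.integrable_const_bound[where B = 1]) auto
    have "(LINT x|std_normal_distribution. cis (v * x)) = of_real (exp (- v\<^sup>2 / 2))"
      using fun_cong[OF char_std_normal_distribution, of v]
      by (simp add: char_def cis_conv_exp mult.commute)
    with int show ?thesis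
      by (subst (asm) integrable_density, simp, simp, simp, subst (asm) integral_density)
         (auto simp: has_bochner_integral_iff)
  qed
  have "has_bochner_integral lborel
          (\<lambda>x. sqrt (2 * pi) *\<^sub>R (std_normal_density (0 + sqrt t * x) *\<^sub>R cis (u / sqrt t * (0 + sqrt t * x))))
          (sqrt (2 * pi) *\<^sub>R (of_real (exp (- (u / sqrt t)\<^sup>2 / 2)) /\<^sub>R \<bar>sqrt t\<bar>))"
    using assms std[of "u / sqrt t"]
    by (intro has_bochner_integral_scaleR_right)
       (subst (asm) lborel_has_bochner_integral_real_affine_iff[where c = "sqrt t" and t = 0], auto)
  also have "(\<lambda>x. sqrt (2 * pi) *\<^sub>R (std_normal_density (0 + sqrt t * x) *\<^sub>R cis (u / sqrt t * (0 + sqrt t * x))))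
      = (\<lambda>x. cis (u * x) * of_real (exp (- t * x\<^sup>2 / 2)))"
    using assms by (auto simp: std_normal_density_def fun_eq_iff scaleR_conv_of_real power_mult_distrib field_simps)
  also have "sqrt (2 * pi) *\<^sub>R (of_real (exp (- (u / sqrt t)\<^sup>2 / 2)) /\<^sub>R \<bar>sqrt t\<bar>)
      = complex_of_real (sqrt (2 * pi / t) * exp (- u\<^sup>2 / (2 * t)))"
    using assms by (simp add: scaleR_conv_of_real power_divide real_sqrt_divide field_simps)
  finally show ?thesis .
qed

lemma has_bochner_integral_lborel_prod:
  fixes f :: "'a::euclidean_space \<Rightarrow> real \<Rightarrow> 'b::{real_normed_field,banach,second_countable_topology}"
  assumes "\<And>b. b \<in> Basis \<Longrightarrow> has_bochner_integral lborel (f b) (c b)"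
  shows "has_bochner_integral lborel (\<lambda>x::'a. \<Prod>b\<in>Basis. f b (x \<bullet> b)) (\<Prod>b\<in>Basis. c b)"
proof -
  interpret product_sigma_finite "\<lambda>b::'a. lborel :: real measure"
    by standard
  have int: "integrable lborel (f b)" and val: "integral\<^sup>L lborel (f b) = c b" if "b \<in> Basis" for b
    using assms[OF that] by (auto simp: has_bochner_integral_iff)
  have [measurable]: "f b \<in> borel_measurable borel" if "b \<in> Basis" for b
    using borel_measurable_integrable[OF int[OF that]] by simp
  let ?F = "\<lambda>x::'a. \<Prod>b\<in>Basis. f b (x \<bullet> b)"
  let ?e = "\<lambda>g. \<Sum>b\<in>(Basis::'a set). g b *\<^sub>R b"
  have F: "?F \<in> borel_measurable borel"
    by measurable
  have e: "?e \<in> (\<Pi>\<^sub>M b\<in>Basis. lborel) \<rightarrow>\<^sub>M borel"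
    by measurable
  have Fe: "?F (?e g) = (\<Prod>b\<in>Basis. f b (g b))" for g
    by (intro prod.cong) (auto simp: inner_sum_left inner_Basis if_distrib cong: if_cong)
  have "integrable (\<Pi>\<^sub>M b\<in>Basis. lborel) (\<lambda>g. \<Prod>b\<in>Basis. f b (g b))"
    by (rule product_integrable_prod) (auto simp: int)
  then have "integrable lborel ?F"
    by (subst lborel_eq, subst integrable_distr_eq[OF e F], subst Fe)
  moreover have "integral\<^sup>L lborel ?F = (\<Prod>b\<in>Basis. c b)"
    by (subst lborel_eq, subst integral_distr[OF e F], subst Fe, subst product_integral_prod)
       (auto simp: int val)
  ultimately show ?thesis
    by (simp add: has_bochner_integral_iff)
qed

lemma power2_norm_eq_sum_Basis: "(norm (x::'a::euclidean_space))\<^sup>2 = (\<Sum>b\<in>Basis. (x \<bullet> b)\<^sup>2)"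
  unfolding power2_norm_eq_inner by (subst euclidean_inner) (simp add: power2_eq_square)

lemma cis_sum: "finite A \<Longrightarrow> cis (\<Sum>i\<in>A. f i) = (\<Prod>i\<in>A. cis (f i))"
  by (induction A rule: finite_induct) (auto simp: cis_mult[symmetric])

lemma gaussian_fourier:
  fixes \<eta> :: "'a::euclidean_space" and t :: real
  assumes "0 < t"
  shows "has_bochner_integral lborel (\<lambda>x. cis (\<eta> \<bullet> x) * of_real (exp (- t * (norm x)\<^sup>2 / 2)))
           (of_real (sqrt (2 * pi / t) ^ DIM('a) * exp (- (norm \<eta>)\<^sup>2 / (2 * t))))"
proof -
  have "has_bochner_integral lborel
          (\<lambda>x::'a. \<Prod>b\<in>Basis. cis ((\<eta> \<bullet> b) * (x \<bullet> b)) * of_real (exp (- t * (x \<bullet> b)\<^sup>2 / 2)))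
          (\<Prod>b\<in>(Basis::'a set). complex_of_real (sqrt (2 * pi / t) * exp (- (\<eta> \<bullet> b)\<^sup>2 / (2 * t))))"
    by (rule has_bochner_integral_lborel_prod) (rule gaussian_fourier_real[OF assms])
  also have "(\<lambda>x::'a. \<Prod>b\<in>Basis. cis ((\<eta> \<bullet> b) * (x \<bullet> b)) * of_real (exp (- t * (x \<bullet> b)\<^sup>2 / 2)))
      = (\<lambda>x. cis (\<eta> \<bullet> x) * of_real (exp (- t * (norm x)\<^sup>2 / 2)))"
  proof
    fix x :: 'a
    have "(\<Prod>b\<in>Basis. cis ((\<eta> \<bullet> b) * (x \<bullet> b))) = cis (\<eta> \<bullet> x)"
      by (subst euclidean_inner) (simp add: cis_sum)
    moreover have "(\<Prod>b\<in>Basis. exp (- t * (x \<bullet> b)\<^sup>2 / 2)) = exp (- t * (norm x)\<^sup>2 / 2)"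
      unfolding power2_norm_eq_sum_Basis sum_distrib_left sum_divide_distrib by (rule exp_sum[symmetric]) simp
    ultimately show "(\<Prod>b\<in>Basis. cis ((\<eta> \<bullet> b) * (x \<bullet> b)) * of_real (exp (- t * (x \<bullet> b)\<^sup>2 / 2)))
        = cis (\<eta> \<bullet> x) * complex_of_real (exp (- t * (norm x)\<^sup>2 / 2))"
      unfolding prod.distrib of_real_prod[symmetric] by simp
  qed
  also have "(\<Prod>b\<in>(Basis::'a set). complex_of_real (sqrt (2 * pi / t) * exp (- (\<eta> \<bullet> b)\<^sup>2 / (2 * t))))
      = of_real (sqrt (2 * pi / t) ^ DIM('a) * exp (- (norm \<eta>)\<^sup>2 / (2 * t)))"
  proof -
    have "(\<Prod>b\<in>(Basis::'a set). exp (- (\<eta> \<bullet> b)\<^sup>2 / (2 * t))) = exp (- (norm \<eta>)\<^sup>2 / (2 * t))"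
      unfolding power2_norm_eq_sum_Basis sum_negf[symmetric] sum_divide_distrib by (rule exp_sum[symmetric]) simp
    then show ?thesis
      unfolding of_real_prod[symmetric] prod.distrib by simp
  qed
  finally show ?thesis .
qed

section \<open>Measures with integrable Fourier transform\<close>

lemma borel_measurable_cis_comp [measurable]:
  "f \<in> borel_measurable M \<Longrightarrow> (\<lambda>x. cis (f x)) \<in> borel_measurable M"
  by (rule measurable_compose[of f M borel cis])
     (auto intro!: borel_measurable_continuous_onI continuous_intros)

text \<open>
  The measures with mass \<open>P I\<close> at the points \<open>y I\<close>, \<open>I \<in> A n\<close>, have Fourier transforms that converge to
  \<open>\<phi>\<close>. Convolution with a Gaussian of variance \<open>t\<close> damps these transforms by an integrable factor, so
  dominated convergence gives the limit of the smoothed measures at each point \<open>x\<close> as an inversion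
  integral, whether or not \<open>\<phi>\<close> is integrable.
\<close>

lemma gaussian_fourier_weak_limit:
  fixes A :: "nat \<Rightarrow> 'i set" and P :: "'i \<Rightarrow> real" and y :: "'i \<Rightarrow> 'a::euclidean_space"
  assumes P: "\<And>n I. I \<in> A n \<Longrightarrow> 0 \<le> P I" "\<And>n. (\<Sum>I\<in>A n. P I) = 1"
    and lim: "\<And>\<xi>. (\<lambda>n. \<Sum>I\<in>A n. P I *\<^sub>R cis (\<xi> \<bullet> y I)) \<longlonglongrightarrow> \<phi> \<xi>"
    and t: "0 < t"
  shows "(\<lambda>n. complex_of_real (\<Sum>I\<in>A n. P I * (sqrt (2 * pi / t) ^ DIM('a) * exp (- (norm (y I - x))\<^sup>2 / (2 * t)))))
           \<longlonglongrightarrow> (LINT \<xi>|lborel. \<phi> \<xi> * cis (- (\<xi> \<bullet> x)) * of_real (exp (- t * (norm \<xi>)\<^sup>2 / 2)))"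
proof -
  define \<phi>n where "\<phi>n = (\<lambda>n \<xi>. \<Sum>I\<in>A n. P I *\<^sub>R cis (\<xi> \<bullet> y I))"
  have lim': "(\<lambda>n. \<phi>n n \<xi>) \<longlonglongrightarrow> \<phi> \<xi>" for \<xi>
    using lim by (simp add: \<phi>n_def)
  have [measurable]: "\<phi>n n \<in> borel_measurable borel" for n
    unfolding \<phi>n_def by measurable
  have [measurable]: "\<phi> \<in> borel_measurable borel"
    by (rule borel_measurable_LIMSEQ_metric[where f = \<phi>n]) (use lim' in auto)
  have bound: "norm (\<phi>n n \<xi>) \<le> 1" for n \<xi>
  proof -
    have "norm (\<phi>n n \<xi>) \<le> (\<Sum>I\<in>A n. norm (P I *\<^sub>R cis (\<xi> \<bullet> y I)))"
      unfolding \<phi>n_def by (rule norm_sum)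
    also have "\<dots> = (\<Sum>I\<in>A n. P I)"
      by (intro sum.cong) (use P in auto)
    finally show ?thesis using P by simp
  qed
  have gauss: "integrable lborel (\<lambda>\<xi>::'a. exp (- t * (norm \<xi>)\<^sup>2 / 2))"
    using gaussian_fourier[OF t, of "0::'a"] by (simp add: has_bochner_integral_iff complex_of_real_integrable_eq)
  have "has_bochner_integral lborel
          (\<lambda>\<xi>. \<Sum>I\<in>A n. P I *\<^sub>R (cis ((y I - x) \<bullet> \<xi>) * of_real (exp (- t * (norm \<xi>)\<^sup>2 / 2))))
          (\<Sum>I\<in>A n. P I *\<^sub>R (complex_of_real (sqrt (2 * pi / t) ^ DIM('a) * exp (- (norm (y I - x))\<^sup>2 / (2 * t)))))"
    for n
    by (intro has_bochner_integral_sum has_bochner_integral_scaleR_right gaussian_fourier t)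
  then have step: "(LINT \<xi>|lborel. (\<Sum>I\<in>A n. P I *\<^sub>R (cis ((y I - x) \<bullet> \<xi>) * of_real (exp (- t * (norm \<xi>)\<^sup>2 / 2)))))
      = (\<Sum>I\<in>A n. P I *\<^sub>R (complex_of_real (sqrt (2 * pi / t) ^ DIM('a) * exp (- (norm (y I - x))\<^sup>2 / (2 * t)))))" for n
    by (rule has_bochner_integral_integral_eq)
  have "(\<lambda>\<xi>. \<Sum>I\<in>A n. P I *\<^sub>R (cis ((y I - x) \<bullet> \<xi>) * of_real (exp (- t * (norm \<xi>)\<^sup>2 / 2))))
      = (\<lambda>\<xi>. \<phi>n n \<xi> * cis (- (\<xi> \<bullet> x)) * complex_of_real (exp (- t * (norm \<xi>)\<^sup>2 / 2)))" for n
    unfolding \<phi>n_def sum_distrib_right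
    by (intro ext sum.cong) (auto simp: cis_mult inner_diff_right inner_commute)
  note step[unfolded this]
  moreover have "(\<lambda>n. LINT \<xi>|lborel. \<phi>n n \<xi> * cis (- (\<xi> \<bullet> x)) * complex_of_real (exp (- t * (norm \<xi>)\<^sup>2 / 2)))
    \<longlonglongrightarrow> (LINT \<xi>|lborel. \<phi> \<xi> * cis (- (\<xi> \<bullet> x)) * of_real (exp (- t * (norm \<xi>)\<^sup>2 / 2)))"
  proof (rule integral_dominated_convergence[OF _ _ gauss])
    show "AE \<xi> in lborel. (\<lambda>n. \<phi>n n \<xi> * cis (- (\<xi> \<bullet> x)) * complex_of_real (exp (- t * (norm \<xi>)\<^sup>2 / 2)))
            \<longlonglongrightarrow> \<phi> \<xi> * cis (- (\<xi> \<bullet> x)) * of_real (exp (- t * (norm \<xi>)\<^sup>2 / 2))"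
      by (intro AE_I2 tendsto_mult lim' tendsto_const)
    show "AE \<xi> in lborel. norm (\<phi>n n \<xi> * cis (- (\<xi> \<bullet> x)) * complex_of_real (exp (- t * (norm \<xi>)\<^sup>2 / 2)))
            \<le> exp (- t * (norm \<xi>)\<^sup>2 / 2)" for n
      using bound by (intro AE_I2) (simp add: norm_mult)
  qed auto
  ultimately show ?thesis
    by (simp add: scaleR_conv_of_real)
qed

text \<open>
  The function \<open>f\<close> of the proof is, up to a constant, the density of the limit measure. It is continuous
  by dominated convergence. At a point at distance \<open>e\<close> from \<open>K\<close> the measures smoothed with variance \<open>t\<close>
  are as small as a Gaussian tail, which tends to 0 with \<open>t\<close>, so \<open>f\<close> vanishes there. If \<open>K\<close> had empty
  interior, then \<open>f\<close> would be 0 everywhere. But its integral against a Gaussian is a limit of Gaussian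
  averages over points in a fixed ball, and these averages are bounded away from 0.
\<close>

lemma interior_nonempty_if_fourier_integrable:
  fixes A :: "nat \<Rightarrow> 'i set" and P :: "'i \<Rightarrow> real" and y :: "'i \<Rightarrow> 'a::euclidean_space"
  assumes "closed K"
    and P: "\<And>n I. I \<in> A n \<Longrightarrow> 0 \<le> P I" "\<And>n. (\<Sum>I\<in>A n. P I) = 1"
    and bounded: "\<And>n I. I \<in> A n \<Longrightarrow> norm (y I) \<le> R"
    and near: "\<And>n I. I \<in> A n \<Longrightarrow> \<exists>z\<in>K. dist (y I) z \<le> \<delta> n" and \<delta>: "\<delta> \<longlonglongrightarrow> 0"
    and lim: "\<And>\<xi>. (\<lambda>n. \<Sum>I\<in>A n. P I *\<^sub>R cis (\<xi> \<bullet> y I)) \<longlonglongrightarrow> \<phi> \<xi>"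
    and int: "integrable lborel \<phi>"
  shows "interior K \<noteq> {}"
proof
  assume empty: "interior K = {}"
  define f where "f = (\<lambda>x. LINT \<xi>|lborel. \<phi> \<xi> * cis (- (\<xi> \<bullet> x)))"
  define ft where "ft = (\<lambda>t x. LINT \<xi>|lborel. \<phi> \<xi> * cis (- (\<xi> \<bullet> x)) * of_real (exp (- t * (norm \<xi>)\<^sup>2 / 2)))"
  have approx: "(\<lambda>n. complex_of_real (\<Sum>I\<in>A n. P I * (sqrt (2 * pi / t) ^ DIM('a) * exp (- (norm (y I - x))\<^sup>2 / (2 * t)))))
      \<longlonglongrightarrow> ft t x" if "0 < t" for t x
    unfolding ft_def using P lim that by (rule gaussian_fourier_weak_limit)
  have [measurable]: "\<phi> \<in> borel_measurable borel"
    using borel_measurable_integrable[OF int] by simp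
  have "isCont f x" for x
    unfolding continuous_at_sequentially comp_def f_def
  proof (intro allI impI)
    fix X :: "nat \<Rightarrow> 'a" assume X: "X \<longlonglongrightarrow> x"
    show "(\<lambda>n. LINT \<xi>|lborel. \<phi> \<xi> * cis (- (\<xi> \<bullet> X n))) \<longlonglongrightarrow> (LINT \<xi>|lborel. \<phi> \<xi> * cis (- (\<xi> \<bullet> x)))"
      by (rule integral_dominated_convergence[where w = "\<lambda>\<xi>. norm (\<phi> \<xi>)"])
         (use int X in \<open>auto intro!: AE_I2 tendsto_intros simp: norm_mult\<close>)
  qed
  then have "open {x. f x \<noteq> 0}"
    by (intro open_Collect_neq continuous_intros) (auto simp: continuous_at_imp_continuous_on)
  moreover have "{x. f x \<noteq> 0} \<subseteq> K"
  proof safe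
    fix x assume "f x \<noteq> 0"
    show "x \<in> K"
    proof (rule ccontr)
      assume "x \<notin> K"
      then obtain e where e: "e > 0" "\<And>z. z \<in> K \<Longrightarrow> e \<le> dist z x"
        using \<open>closed K\<close> by (metis linorder_not_le open_Compl open_dist ComplI ComplD closed_def)
      have small: "norm (ft t x) \<le> sqrt (2 * pi / t) ^ DIM('a) * exp (- (e/2)\<^sup>2 / (2 * t))" if "0 < t" for t
      proof (rule tendsto_upperbound[OF tendsto_norm[OF approx[OF that, of x]]])
        have "\<forall>\<^sub>F n in sequentially. \<delta> n < e / 2"
          using \<delta> e by (intro order_tendstoD) auto
        then show "\<forall>\<^sub>F n in sequentially. norm (complex_of_real
            (\<Sum>I\<in>A n. P I * (sqrt (2 * pi / t) ^ DIM('a) * exp (- (norm (y I - x))\<^sup>2 / (2 * t)))))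
            \<le> sqrt (2 * pi / t) ^ DIM('a) * exp (- (e/2)\<^sup>2 / (2 * t))" (is "\<forall>\<^sub>F n in _. norm (complex_of_real (?S n)) \<le> ?B")
        proof eventually_elim
          fix n assume n: "\<delta> n < e / 2"
          have "?S n \<le> (\<Sum>I\<in>A n. P I * ?B)"
          proof (intro sum_mono mult_left_mono)
            fix I assume I: "I \<in> A n"
            then obtain z where z: "z \<in> K" "dist (y I) z \<le> \<delta> n" using near by blast
            have "e \<le> dist z x" using e z by auto
            also have "\<dots> \<le> dist (y I) z + dist (y I) x" by (metis dist_commute dist_triangle)
            finally have "e / 2 \<le> norm (y I - x)" using z n by (simp add: dist_norm)
            then have "(e/2)\<^sup>2 \<le> (norm (y I - x))\<^sup>2" using e by (intro power_mono) auto
            then show "exp (- (norm (y I - x))\<^sup>2 / (2 * t)) \<le> exp (- (e/2)\<^sup>2 / (2 * t))"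
              using that by (simp add: divide_right_mono)
            show "0 \<le> P I" using P I by auto
          qed (use that in simp)
          also have "\<dots> = ?B" using P by (simp add: sum_distrib_right[symmetric])
          finally have "?S n \<le> ?B" .
          moreover have "0 \<le> ?S n" using P that by (intro sum_nonneg mult_nonneg_nonneg) auto
          ultimately show "norm (complex_of_real (?S n)) \<le> ?B" unfolding norm_of_real by simp
        qed
      qed simp
      \<comment> \<open>The variances \<open>2 * pi / n\<^sup>2\<close> tend to 0 and turn the normalising factor into a power of \<open>n\<close>.\<close>
      have "(\<lambda>n. ft (2 * pi / (real n)\<^sup>2) x) \<longlonglongrightarrow> f x"
        unfolding ft_def f_def
      proof (rule integral_dominated_convergence[where w = "\<lambda>\<xi>. norm (\<phi> \<xi>)"])
        show "AE \<xi> in lborel. (\<lambda>n. \<phi> \<xi> * cis (- (\<xi> \<bullet> x)) * complex_of_real (exp (- (2 * pi / (real n)\<^sup>2) * (norm \<xi>)\<^sup>2 / 2)))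
              \<longlonglongrightarrow> \<phi> \<xi> * cis (- (\<xi> \<bullet> x))"
        proof (rule AE_I2)
          fix \<xi> :: 'a
          have "(\<lambda>n. exp (- (2 * pi / (real n)\<^sup>2) * (norm \<xi>)\<^sup>2 / 2)) \<longlonglongrightarrow> 1"
            by real_asymp
          from tendsto_mult[OF tendsto_const[of "\<phi> \<xi> * cis (- (\<xi> \<bullet> x))"] tendsto_of_real[OF this]]
          show "(\<lambda>n. \<phi> \<xi> * cis (- (\<xi> \<bullet> x)) * complex_of_real (exp (- (2 * pi / (real n)\<^sup>2) * (norm \<xi>)\<^sup>2 / 2)))
              \<longlonglongrightarrow> \<phi> \<xi> * cis (- (\<xi> \<bullet> x))"
            by (simp only: of_real_1 mult_1_right)
        qed
        show "AE \<xi> in lborel. norm (\<phi> \<xi> * cis (- (\<xi> \<bullet> x)) * complex_of_real (exp (- (2 * pi / (real n)\<^sup>2) * (norm \<xi>)\<^sup>2 / 2)))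
              \<le> norm (\<phi> \<xi>)" for n
          by (intro AE_I2) (auto simp: norm_mult intro!: mult_left_le)
      qed (use int in auto)
      moreover have "(\<lambda>n. ft (2 * pi / (real n)\<^sup>2) x) \<longlonglongrightarrow> 0"
      proof (rule Lim_null_comparison)
        define c where "c = (e/2)\<^sup>2 / (4 * pi)"
        have "c > 0" using e by (simp add: c_def)
        have "((\<lambda>u. (c * u\<^sup>2) ^ DIM('a) / exp (c * u\<^sup>2) * (1 / c) ^ DIM('a)) \<longlongrightarrow> 0 * (1 / c) ^ DIM('a)) at_top"
          by (intro tendsto_mult tendsto_const filterlim_compose[OF tendsto_power_div_exp_0])
             (use \<open>c > 0\<close> in real_asymp)
        then show "(\<lambda>n. (c * (real n)\<^sup>2) ^ DIM('a) / exp (c * (real n)\<^sup>2) * (1 / c) ^ DIM('a)) \<longlonglongrightarrow> 0"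
          using filterlim_compose filterlim_real_sequentially by force
        show "\<forall>\<^sub>F n in sequentially. norm (ft (2 * pi / (real n)\<^sup>2) x)
                \<le> (c * (real n)\<^sup>2) ^ DIM('a) / exp (c * (real n)\<^sup>2) * (1 / c) ^ DIM('a)"
          using eventually_gt_at_top[of 0]
        proof eventually_elim
          fix n :: nat assume n: "0 < n"
          have "norm (ft (2 * pi / (real n)\<^sup>2) x) \<le> sqrt ((real n)\<^sup>2) ^ DIM('a) * exp (- c * (real n)\<^sup>2)"
            using small[of "2 * pi / (real n)\<^sup>2"] n by (simp add: c_def field_simps)
          also have "\<dots> \<le> ((real n)\<^sup>2) ^ DIM('a) * exp (- c * (real n)\<^sup>2)"
            using n by (intro mult_right_mono power_mono) (auto simp: power2_eq_square)
          also have "\<dots> = (c * (real n)\<^sup>2) ^ DIM('a) / exp (c * (real n)\<^sup>2) * (1 / c) ^ DIM('a)"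
            using \<open>c > 0\<close> by (simp add: exp_minus field_simps power_mult_distrib)
          finally show "norm (ft (2 * pi / (real n)\<^sup>2) x)
              \<le> (c * (real n)\<^sup>2) ^ DIM('a) / exp (c * (real n)\<^sup>2) * (1 / c) ^ DIM('a)" .
        qed
      qed
      ultimately have "f x = 0" by (rule LIMSEQ_unique)
      with \<open>f x \<noteq> 0\<close> show False by simp
    qed
  qed
  ultimately have "{x. f x \<noteq> 0} \<subseteq> interior K" by (rule interior_maximal[rotated])
  then have f0: "f x = 0" for x using empty by auto
  define g where "g = (\<lambda>x::'a. exp (- 1 * (norm x)\<^sup>2 / 2))"
  \<comment> \<open>Fubini for \<open>F\<close> expresses the integral of \<open>f * g\<close> through the smoothed value \<open>ft 1 0\<close>.\<close>
  define F where "F = (\<lambda>(\<xi>, x). \<phi> \<xi> * (cis ((- \<xi>) \<bullet> x) * complex_of_real (g x)))"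
  have gauss: "has_bochner_integral lborel (\<lambda>x. cis (\<eta> \<bullet> x) * complex_of_real (g x)) (of_real (sqrt (2 * pi) ^ DIM('a) * g \<eta>))" for \<eta>
    using gaussian_fourier[of 1 \<eta>] unfolding g_def by simp
  have [measurable]: "g \<in> borel_measurable borel" unfolding g_def by measurable
  have gint: "integrable lborel g"
    using gauss[of 0] by (simp add: has_bochner_integral_iff complex_of_real_integrable_eq)
  have "integrable (lborel \<Otimes>\<^sub>M lborel) F"
  proof (rule lborel_pair.Fubini_integrable)
    show "F \<in> borel_measurable (lborel \<Otimes>\<^sub>M lborel)" unfolding F_def by measurable
    have "(LINT x|lborel. norm (F (\<xi>, x))) = norm (\<phi> \<xi>) * integral\<^sup>L lborel g" for \<xi>
      by (simp add: F_def norm_mult g_def)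
    then show "integrable lborel (\<lambda>\<xi>. LINT x|lborel. norm (F (\<xi>, x)))"
      using int by simp
    show "AE \<xi> in lborel. integrable lborel (\<lambda>x. F (\<xi>, x))"
      using gauss unfolding F_def prod.case has_bochner_integral_iff
      by (intro AE_I2 integrable_mult_right) blast
  qed
  from lborel_pair.Fubini_integral[of "\<lambda>\<xi> x. F (\<xi>, x)"] this
  have fubini: "(LINT x|lborel. LINT \<xi>|lborel. F (\<xi>, x)) = (LINT \<xi>|lborel. LINT x|lborel. F (\<xi>, x))" by simp
  have "(LINT \<xi>|lborel. F (\<xi>, x)) = f x * of_real (g x)" for x
    unfolding F_def f_def by (simp add: mult.assoc[symmetric])
  then have zero: "(LINT x|lborel. LINT \<xi>|lborel. F (\<xi>, x)) = 0"
    using f0 by simp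
  have "(LINT x|lborel. F (\<xi>, x)) = of_real (sqrt (2 * pi) ^ DIM('a)) * (\<phi> \<xi> * cis (- (\<xi> \<bullet> 0)) * of_real (g \<xi>))" for \<xi>
    unfolding F_def using has_bochner_integral_integral_eq[OF gauss[of "- \<xi>"]] by (simp add: g_def)
  then have "(LINT \<xi>|lborel. LINT x|lborel. F (\<xi>, x)) = of_real (sqrt (2 * pi) ^ DIM('a)) * ft 1 0"
    unfolding ft_def g_def by (simp only: integral_mult_right_zero)
  with fubini zero have "ft 1 0 = 0" by simp
  moreover have "norm (ft 1 0) \<ge> sqrt (2 * pi) ^ DIM('a) * exp (- R\<^sup>2 / 2)"
  proof (rule tendsto_lowerbound[OF tendsto_norm[OF approx[of 1 0]]])
    show "\<forall>\<^sub>F n in sequentially. sqrt (2 * pi) ^ DIM('a) * exp (- R\<^sup>2 / 2) \<le> norm (complex_of_real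
            (\<Sum>I\<in>A n. P I * (sqrt (2 * pi / 1) ^ DIM('a) * exp (- (norm (y I - 0))\<^sup>2 / (2 * 1)))))"
    proof (intro always_eventually allI)
      fix n
      have "sqrt (2 * pi) ^ DIM('a) * exp (- R\<^sup>2 / 2) = (\<Sum>I\<in>A n. P I * (sqrt (2 * pi / 1) ^ DIM('a) * exp (- R\<^sup>2 / (2 * 1))))"
        using P by (simp add: sum_distrib_right[symmetric])
      also have "\<dots> \<le> (\<Sum>I\<in>A n. P I * (sqrt (2 * pi / 1) ^ DIM('a) * exp (- (norm (y I - 0))\<^sup>2 / (2 * 1))))"
        using P bounded by (intro sum_mono mult_left_mono) (auto intro!: power_mono)
      finally show "sqrt (2 * pi) ^ DIM('a) * exp (- R\<^sup>2 / 2) \<le> norm (complex_of_real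
            (\<Sum>I\<in>A n. P I * (sqrt (2 * pi / 1) ^ DIM('a) * exp (- (norm (y I - 0))\<^sup>2 / (2 * 1)))))"
        unfolding norm_of_real by linarith
    qed
  qed auto
  moreover have "0 < sqrt (2 * pi) ^ DIM('a) * exp (- R\<^sup>2 / 2)"
    by (intro mult_pos_pos zero_less_power) auto
  ultimately show False by (metis norm_zero not_le)
qed

section \<open>Linear change of variables\<close>

lemma prod_Basis_vec: "(\<Prod>b\<in>(Basis :: (real^'n) set). g b) = (\<Prod>i\<in>UNIV. g (axis i 1))"
proof -
  have "(Basis :: (real^'n) set) = (\<lambda>i. axis i 1) ` UNIV"
    by (auto simp: Basis_vec_def)
  moreover have "inj (\<lambda>i::'n. axis i (1::real))"
    by (auto simp: inj_on_def axis_eq_axis)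
  ultimately show ?thesis
    by (metis (no_types, lifting) prod.reindex_cong)
qed

lemma nn_integral_lborel_translate:
  fixes c :: "'a::euclidean_space"
  assumes [measurable]: "f \<in> borel_measurable borel"
  shows "(\<integral>\<^sup>+x. f (x + c) \<partial>lborel) = (\<integral>\<^sup>+x. f x \<partial>lborel)"
proof -
  have "(\<integral>\<^sup>+x. f x \<partial>lborel) = (\<integral>\<^sup>+x. f x \<partial>distr lborel borel ((+) c))"
    by (simp add: lborel_distr_plus)
  also have "\<dots> = (\<integral>\<^sup>+x. f (x + c) \<partial>lborel)"
    by (subst nn_integral_distr) (auto simp: add.commute)
  finally show ?thesis ..
qed

text \<open>
  Translating by \<open>y *\<^sub>R v\<close> does not change the left-hand side and, as \<open>u \<bullet> v = 0\<close>, turns the shift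
  \<open>x \<bullet> u\<close> into \<open>x \<bullet> u + y\<close>. Averaging over \<open>y\<close> in the unit interval gives a double integral in which, after
  the substitution \<open>y \<mapsto> y - x \<bullet> u\<close>, the shift is \<open>y\<close> alone and can be removed by a translation in \<open>x\<close>. The
  dependence on \<open>x \<bullet> u\<close> is then confined to the indicator of an interval of length 1, which integrates
  to 1.
\<close>

lemma nn_integral_lborel_shear:
  fixes u v :: "'a::euclidean_space"
  assumes [measurable]: "f \<in> borel_measurable borel" and orth: "u \<bullet> v = 0"
  shows "(\<integral>\<^sup>+x. f (x + (x \<bullet> u) *\<^sub>R v) \<partial>lborel) = (\<integral>\<^sup>+x. f x \<partial>lborel)"
proof -
  let ?I = "\<lambda>t y::real. indicator {t..t + 1} y :: ennreal"
  have [measurable]: "(\<lambda>(x, y). ?I (x \<bullet> u) y) \<in> borel_measurable (lborel \<Otimes>\<^sub>M lborel)"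
  proof -
    have "(\<lambda>(x, y). ?I (x \<bullet> u) y) = (\<lambda>(x, y). if x \<bullet> u \<le> y \<and> y \<le> x \<bullet> u + 1 then 1 else 0)"
      by (auto simp: indicator_def fun_eq_iff)
    then show ?thesis by simp
  qed
  have unit: "(\<integral>\<^sup>+y. ?I t y \<partial>lborel) = 1" for t
    by simp
  have "(\<integral>\<^sup>+x. f (x + (x \<bullet> u) *\<^sub>R v) \<partial>lborel)
      = (\<integral>\<^sup>+y. ?I 0 y * (\<integral>\<^sup>+x. f (x + (x \<bullet> u) *\<^sub>R v) \<partial>lborel) \<partial>lborel)"
    using unit[of 0] by (subst nn_integral_multc) auto
  also have "\<dots> = (\<integral>\<^sup>+y. \<integral>\<^sup>+x. ?I 0 y * f (x + (x \<bullet> u + y) *\<^sub>R v) \<partial>lborel \<partial>lborel)"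
  proof (rule nn_integral_cong)
    fix y :: real
    have "(\<integral>\<^sup>+x. f ((x + y *\<^sub>R v) + ((x + y *\<^sub>R v) \<bullet> u) *\<^sub>R v) \<partial>lborel) = (\<integral>\<^sup>+x. f (x + (x \<bullet> u) *\<^sub>R v) \<partial>lborel)"
      by (rule nn_integral_lborel_translate[where f = "\<lambda>x. f (x + (x \<bullet> u) *\<^sub>R v)"]) simp
    moreover have "(x + y *\<^sub>R v) + ((x + y *\<^sub>R v) \<bullet> u) *\<^sub>R v = x + (x \<bullet> u + y) *\<^sub>R v" for x
      using orth by (simp add: inner_add_left inner_commute algebra_simps)
    ultimately show "?I 0 y * (\<integral>\<^sup>+x. f (x + (x \<bullet> u) *\<^sub>R v) \<partial>lborel)
        = (\<integral>\<^sup>+x. ?I 0 y * f (x + (x \<bullet> u + y) *\<^sub>R v) \<partial>lborel)"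
      by (simp add: nn_integral_cmult)
  qed
  also have "\<dots> = (\<integral>\<^sup>+x. \<integral>\<^sup>+y. ?I 0 y * f (x + (x \<bullet> u + y) *\<^sub>R v) \<partial>lborel \<partial>lborel)"
    by (rule lborel_pair.Fubini') simp
  also have "\<dots> = (\<integral>\<^sup>+x. \<integral>\<^sup>+y. ?I (x \<bullet> u) y * f (x + y *\<^sub>R v) \<partial>lborel \<partial>lborel)"
  proof (rule nn_integral_cong)
    fix x :: 'a
    have "(\<integral>\<^sup>+y. ?I (x \<bullet> u) (y + x \<bullet> u) * f (x + (y + x \<bullet> u) *\<^sub>R v) \<partial>lborel)
        = (\<integral>\<^sup>+y. ?I (x \<bullet> u) y * f (x + y *\<^sub>R v) \<partial>lborel)"
      by (rule nn_integral_lborel_translate[where f = "\<lambda>y. ?I (x \<bullet> u) y * f (x + y *\<^sub>R v)"]) simp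
    moreover have "?I (x \<bullet> u) (y + x \<bullet> u) = ?I 0 y" for y
      by (auto simp: indicator_def)
    ultimately show "(\<integral>\<^sup>+y. ?I 0 y * f (x + (x \<bullet> u + y) *\<^sub>R v) \<partial>lborel)
        = (\<integral>\<^sup>+y. ?I (x \<bullet> u) y * f (x + y *\<^sub>R v) \<partial>lborel)"
      by (simp add: add.commute)
  qed
  also have "\<dots> = (\<integral>\<^sup>+y. \<integral>\<^sup>+x. ?I (x \<bullet> u) y * f (x + y *\<^sub>R v) \<partial>lborel \<partial>lborel)"
    by (rule lborel_pair.Fubini'[symmetric]) measurable
  also have "\<dots> = (\<integral>\<^sup>+y. \<integral>\<^sup>+x. ?I (x \<bullet> u) y * f x \<partial>lborel \<partial>lborel)"
  proof (rule nn_integral_cong)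
    fix y :: real
    have "(\<integral>\<^sup>+x. ?I ((x + y *\<^sub>R v) \<bullet> u) y * f (x + y *\<^sub>R v) \<partial>lborel) = (\<integral>\<^sup>+x. ?I (x \<bullet> u) y * f x \<partial>lborel)"
      by (rule nn_integral_lborel_translate[where f = "\<lambda>x. ?I (x \<bullet> u) y * f x"]) measurable
    moreover have "(x + y *\<^sub>R v) \<bullet> u = x \<bullet> u" for x
      using orth by (simp add: inner_add_left inner_commute[of v])
    ultimately show "(\<integral>\<^sup>+x. ?I (x \<bullet> u) y * f (x + y *\<^sub>R v) \<partial>lborel) = (\<integral>\<^sup>+x. ?I (x \<bullet> u) y * f x \<partial>lborel)"
      by simp
  qed
  also have "\<dots> = (\<integral>\<^sup>+x. \<integral>\<^sup>+y. ?I (x \<bullet> u) y * f x \<partial>lborel \<partial>lborel)"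
    by (rule lborel_pair.Fubini') measurable
  also have "\<dots> = (\<integral>\<^sup>+x. f x \<partial>lborel)"
    by (simp add: nn_integral_multc)
  finally show ?thesis .
qed

lemma borel_measurable_matrix_vector_mult [measurable]:
  fixes A :: "real^'n^'m"
  shows "(\<lambda>x. A *v x) \<in> borel_measurable borel"
  by (intro borel_measurable_continuous_onI matrix_vector_mult_linear_continuous_on)

text \<open>
  The formula is stable under products of matrices, so it suffices to verify it for the elementary ones:
  diagonal matrices scale the coordinates, transpositions permute the sides of boxes, and the remaining
  ones are shears.
\<close>

lemma nn_integral_lborel_matrix:
  fixes A :: "real^'n^'n"
  assumes "det A \<noteq> 0" "f \<in> borel_measurable borel"
  shows "(\<integral>\<^sup>+x. f x \<partial>lborel) = ennreal \<bar>det A\<bar> * (\<integral>\<^sup>+x. f (A *v x) \<partial>lborel)"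
proof -
  define P where "P = (\<lambda>A::real^'n^'n. det A \<noteq> 0 \<longrightarrow>
    (\<forall>f\<in>borel_measurable borel. (\<integral>\<^sup>+x. f x \<partial>lborel) = ennreal \<bar>det A\<bar> * (\<integral>\<^sup>+x. f (A *v x) \<partial>lborel)))"
  have PD: "(\<integral>\<^sup>+x. f x \<partial>lborel) = ennreal \<bar>det A\<bar> * (\<integral>\<^sup>+x. f (A *v x) \<partial>lborel)"
    if "P A" "det A \<noteq> 0" "f \<in> borel_measurable borel" for A f
    using that unfolding P_def by blast
  have "P A"
  proof (rule induct_matrix_elementary_alt[of P])
    fix A B :: "real^'n^'n"
    assume PA: "P A" and PB: "P B"
    show "P (A ** B)"
      unfolding P_def
    proof (intro impI ballI)
      fix f :: "real^'n \<Rightarrow> ennreal"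
      assume det: "det (A ** B) \<noteq> 0" and f [measurable]: "f \<in> borel_measurable borel"
      have "(\<integral>\<^sup>+x. f x \<partial>lborel) = ennreal \<bar>det A\<bar> * (\<integral>\<^sup>+x. f (A *v x) \<partial>lborel)"
        by (rule PD[OF PA _ f]) (use det in \<open>simp add: det_mul\<close>)
      also have "(\<integral>\<^sup>+x. f (A *v x) \<partial>lborel) = ennreal \<bar>det B\<bar> * (\<integral>\<^sup>+x. f (A *v (B *v x)) \<partial>lborel)"
        by (rule PD[OF PB]) (use det in \<open>simp_all add: det_mul\<close>)
      finally show "(\<integral>\<^sup>+x. f x \<partial>lborel) = ennreal \<bar>det (A ** B)\<bar> * (\<integral>\<^sup>+x. f (A ** B *v x) \<partial>lborel)"
        by (simp add: det_mul abs_mult ennreal_mult mult.assoc matrix_vector_mul_assoc)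
    qed
  next
    fix A :: "real^'n^'n" and i
    assume "row i A = 0"
    then show "P A" by (simp add: P_def det_zero_row)
  next
    fix A :: "real^'n^'n"
    assume diag: "\<And>i j. i \<noteq> j \<Longrightarrow> A $ i $ j = 0"
    show "P A"
      unfolding P_def
    proof (intro impI ballI)
      fix f :: "real^'n \<Rightarrow> ennreal"
      assume det: "det A \<noteq> 0" and f [measurable]: "f \<in> borel_measurable borel"
      have detA: "det A = (\<Prod>i\<in>UNIV. A $ i $ i)" using diag by (rule det_diagonal)
      define c where "c = (\<lambda>b::real^'n. (A *v b) \<bullet> b)"
      have c: "c (axis i 1) = A $ i $ i" for i
        by (simp add: c_def inner_axis matrix_vector_mul_component inner_axis')
      have Ai: "A *v axis i 1 = c (axis i 1) *\<^sub>R axis i 1" for i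
        using diag by (auto simp: vec_eq_iff c matrix_vector_mul_component inner_axis) (auto simp: axis_def)
      have A: "A *v x = 0 + (\<Sum>b\<in>Basis. (c b * (x \<bullet> b)) *\<^sub>R b)" for x
      proof -
        have "A *v x = A *v (\<Sum>b\<in>Basis. (x \<bullet> b) *\<^sub>R b)" by (simp add: euclidean_representation)
        also have "\<dots> = (\<Sum>b\<in>Basis. (x \<bullet> b) *\<^sub>R (A *v b))"
          by (simp add: linear_sum[OF matrix_vector_mul_linear] matrix_vector_mult_scaleR)
        also have "\<dots> = (\<Sum>b\<in>Basis. (c b * (x \<bullet> b)) *\<^sub>R b)"
          by (intro sum.cong) (auto simp: Basis_vec_def Ai)
        finally show ?thesis by simp
      qed
      have nz: "c b \<noteq> 0" if "b \<in> Basis" for b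
        using that det by (auto simp: Basis_vec_def c detA)
      have "(\<integral>\<^sup>+x. f x \<partial>lborel) = (\<integral>\<^sup>+x. f x \<partial>density (distr lborel borel (\<lambda>x. 0 + (\<Sum>b\<in>Basis. (c b * (x \<bullet> b)) *\<^sub>R b))) (\<lambda>_. (\<Prod>b\<in>Basis. \<bar>c b\<bar>)))"
        using lborel_affine_euclidean[of c 0, OF nz] by simp
      also have "\<dots> = (\<Prod>b\<in>Basis. \<bar>c b\<bar>) * (\<integral>\<^sup>+x. f (A *v x) \<partial>lborel)"
        unfolding A[symmetric] by (simp add: nn_integral_density nn_integral_distr nn_integral_cmult)
      also have "(\<Prod>b\<in>Basis. \<bar>c b\<bar>) = \<bar>det A\<bar>"
        by (simp add: prod_Basis_vec c detA abs_prod)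
      finally show "(\<integral>\<^sup>+x. f x \<partial>lborel) = ennreal \<bar>det A\<bar> * (\<integral>\<^sup>+x. f (A *v x) \<partial>lborel)" .
    qed
  next
    fix m n :: 'n
    assume "m \<noteq> n"
    let ?\<tau> = "Transposition.transpose m n"
    let ?A = "(\<chi> i j. mat 1 $ i $ ?\<tau> j) :: real^'n^'n"
    have inv: "i = ?\<tau> j \<longleftrightarrow> j = ?\<tau> i" for i j
      by (metis transpose_involutory)
    have Ax: "(?A *v x) $ i = x $ ?\<tau> i" for x i
    proof -
      have "(?A *v x) $ i = (\<Sum>j\<in>UNIV. if j = ?\<tau> i then x $ j else 0)"
        by (simp add: matrix_vector_mult_def mat_def inv if_distrib[of "\<lambda>c. c * y" for y] cong: if_cong)
      then show ?thesis by simp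
    qed
    have bij: "bij ?\<tau>" by (rule bij_transpose)
    have "lborel = distr lborel borel (\<lambda>x. ?A *v x)"
    proof (rule lborel_eqI)
      fix l u :: "real^'n"
      assume le: "\<And>b. b \<in> Basis \<Longrightarrow> l \<bullet> b \<le> u \<bullet> b"
      have li: "l $ i \<le> u $ i" for i using le[of "axis i 1"] by (simp add: inner_axis)
      have "(\<lambda>x. ?A *v x) -` box l u = box (\<chi> i. l $ ?\<tau> i) (\<chi> i. u $ ?\<tau> i)"
      proof (intro set_eqI)
        fix x
        have "(\<forall>i. l $ i < x $ ?\<tau> i \<and> x $ ?\<tau> i < u $ i) \<longleftrightarrow> (\<forall>i. l $ ?\<tau> i < x $ i \<and> x $ i < u $ ?\<tau> i)"
          by (metis transpose_involutory)
        then show "x \<in> (\<lambda>x. ?A *v x) -` box l u \<longleftrightarrow> x \<in> box (\<chi> i. l $ ?\<tau> i) (\<chi> i. u $ ?\<tau> i)"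
          unfolding vimage_eq mem_box_cart Ax by simp
      qed
      then have "emeasure (distr lborel borel (\<lambda>x. ?A *v x)) (box l u)
          = emeasure lborel (box (\<chi> i. l $ ?\<tau> i) (\<chi> i. u $ ?\<tau> i))"
        by (simp add: emeasure_distr)
      also have "\<dots> = ennreal (\<Prod>b\<in>Basis. ((\<chi> i. u $ ?\<tau> i) - (\<chi> i. l $ ?\<tau> i)) \<bullet> b)"
        by (rule emeasure_lborel_box) (auto simp: Basis_vec_def inner_axis li)
      also have "(\<Prod>b\<in>Basis. ((\<chi> i. u $ ?\<tau> i) - (\<chi> i. l $ ?\<tau> i)) \<bullet> b) = (\<Prod>i\<in>UNIV. (u - l) $ ?\<tau> i)"
        by (simp add: prod_Basis_vec inner_axis)
      also have "\<dots> = (\<Prod>i\<in>UNIV. (u - l) $ i)"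
        by (rule prod.reindex_bij_betw[OF bij])
      also have "\<dots> = (\<Prod>b\<in>Basis. (u - l) \<bullet> b)"
        by (simp add: prod_Basis_vec inner_axis)
      finally show "emeasure (distr lborel borel (\<lambda>x. ?A *v x)) (box l u) = (\<Prod>b\<in>Basis. (u - l) \<bullet> b)" .
    qed simp
    then have "(\<integral>\<^sup>+x. f (?A *v x) \<partial>lborel) = (\<integral>\<^sup>+x. f x \<partial>lborel)" if "f \<in> borel_measurable borel" for f
      using nn_integral_distr[of "\<lambda>x. ?A *v x" lborel borel f] that by simp
    moreover have "\<bar>det ?A\<bar> = 1"
      using det_permute_columns[OF permutes_swap_id[of m UNIV n], of "mat 1 :: real^'n^'n"]
      by (simp add: abs_mult sign_swap_id)
    ultimately show "P ?A" by (simp add: P_def)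
  next
    fix m n :: 'n
    assume mn: "m \<noteq> n"
    let ?A = "(\<chi> i j. of_bool (i = m \<and> j = n \<or> i = j)) :: real^'n^'n"
    have "?A *v x = x + (x \<bullet> axis n 1) *\<^sub>R axis m 1" for x
    proof -
      have "(?A *v x) $ i = x $ i + (if i = m then x $ n else 0)" for i
      proof -
        have "(?A *v x) $ i = (\<Sum>j\<in>UNIV. (if j = i then x $ j else 0) + (if j = n then (if i = m then x $ j else 0) else 0))"
          unfolding matrix_vector_mult_def using mn by (auto intro!: sum.cong)
        then show ?thesis by (simp add: sum.distrib)
      qed
      moreover have "(axis m 1 :: real^'n) $ i = (if i = m then 1 else 0)" for i
        by (simp add: axis_def)
      ultimately show ?thesis by (simp add: vec_eq_iff inner_axis)
    qed
    moreover have "det ?A = 1"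
    proof -
      have "?A = (\<chi> k. if k = m then row m (mat 1) + row n (mat 1) else row k (mat 1))"
        using mn by (auto simp: vec_eq_iff row_def mat_def)
      also have "det \<dots> = det (mat 1 :: real^'n^'n)"
        using mn by (intro det_row_span vec.span_base) auto
      finally show ?thesis by simp
    qed
    moreover have "(axis n 1 :: real^'n) \<bullet> axis m 1 = 0"
      using mn by (simp add: inner_axis_axis)
    ultimately show "P ?A"
      by (simp add: P_def nn_integral_lborel_shear)
  qed
  then show ?thesis using assms by (rule PD)
qed

text \<open>
  If \<open>det A \<noteq> 0\<close>, the preimage of the unit ball has the volume of the unit ball divided by \<open>\<bar>det A\<bar>\<close>,
  and it contains the unit ball.
\<close>

lemma abs_det_le_one_if_nonexpansive:
  fixes A :: "real^'n^'n"
  assumes A: "\<And>x. norm (A *v x) \<le> norm x"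
  shows "\<bar>det A\<bar> \<le> 1"
proof (cases "det A = 0")
  case False
  let ?I = "indicator (ball 0 1) :: real^'n \<Rightarrow> ennreal"
  define v where "v = measure lborel (ball (0::real^'n) 1)"
  have v: "emeasure lborel (ball (0::real^'n) 1) = ennreal v"
    unfolding v_def by (rule emeasure_eq_ennreal_measure) (use emeasure_lborel_ball_finite[of "0::real^'n" 1] in auto)
  have "0 < v" unfolding v_def by (simp add: content_ball_pos)
  have "ennreal \<bar>det A\<bar> * ennreal v = ennreal \<bar>det A\<bar> * (\<integral>\<^sup>+x. ?I x \<partial>lborel)"
    by (simp add: v)
  also have "\<dots> \<le> ennreal \<bar>det A\<bar> * (\<integral>\<^sup>+x. ?I (A *v x) \<partial>lborel)"
    using A by (intro mult_left_mono nn_integral_mono) (auto simp: indicator_def intro: le_less_trans)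
  also have "\<dots> = (\<integral>\<^sup>+x. ?I x \<partial>lborel)"
    using False by (intro nn_integral_lborel_matrix[symmetric] borel_measurable_indicator) auto
  also have "\<dots> = ennreal v" by (simp add: v)
  finally have "\<bar>det A\<bar> * v \<le> v" using \<open>0 < v\<close> by (simp add: ennreal_mult[symmetric])
  then show ?thesis using \<open>0 < v\<close> by simp
qed simp

section \<open>Weighted integrals over Euclidean space\<close>

lemma nn_integral_japanese_bracket_real:
  fixes p :: real
  assumes p: "1 / 2 < p"
  shows "(\<integral>\<^sup>+x. ennreal ((1 + x\<^sup>2) powr (- p)) \<partial>lborel) < \<infinity>"
proof -
  let ?g = "\<lambda>x::real. ennreal ((1 + x\<^sup>2) powr (- p))"
  have half: "(\<integral>\<^sup>+x. ?g x * indicator {0..} x \<partial>lborel) < \<infinity>"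
  proof -
    have "(\<integral>\<^sup>+x. ?g x * indicator {0..} x \<partial>lborel)
        \<le> (\<integral>\<^sup>+x. ennreal (2 powr p * (1 + x) powr (- 2 * p)) * indicator {0..} x \<partial>lborel)"
    proof (intro nn_integral_mono)
      fix x :: real
      show "?g x * indicator {0..} x \<le> ennreal (2 powr p * (1 + x) powr (- 2 * p)) * indicator {0..} x"
      proof (cases "0 \<le> x")
        case True
        have "0 \<le> (1 - x)\<^sup>2" by simp
        then have "(1 + x)\<^sup>2 / 2 \<le> 1 + x\<^sup>2" by (simp add: power2_eq_square field_simps)
        then have "(1 + x\<^sup>2) powr (- p) \<le> ((1 + x)\<^sup>2 / 2) powr (- p)"
          using True p by (intro powr_mono2') auto
        also have "\<dots> = 2 powr p * (1 + x) powr (- 2 * p)"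
          using True by (simp add: powr_divide powr_minus powr_powr field_simps flip: powr_numeral)
        finally show ?thesis using True by (simp add: ennreal_leI)
      qed simp
    qed
    also have "\<dots> = ennreal (0 - 2 powr p * (1 + 0) powr (1 - 2 * p) / (1 - 2 * p))"
    proof (rule nn_integral_FTC_atLeast)
      show "((\<lambda>x. 2 powr p * (1 + x) powr (1 - 2 * p) / (1 - 2 * p)) \<longlongrightarrow> 0) at_top"
        using p by real_asymp
      show "((\<lambda>x. 2 powr p * (1 + x) powr (1 - 2 * p) / (1 - 2 * p)) has_real_derivative
              2 powr p * (1 + x) powr (- 2 * p)) (at x)" if "0 \<le> x" for x
      proof -
        have "((\<lambda>x. (1 + x) powr (1 - 2 * p)) has_real_derivative (1 - 2 * p) * (1 + x) powr (1 - 2 * p - 1)) (at x)"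
          using that by (auto intro!: derivative_eq_intros)
        from DERIV_cdivide[OF DERIV_cmult[OF this, of "2 powr p"], of "1 - 2 * p"]
        show ?thesis using p by simp
      qed
    qed auto
    also have "\<dots> < \<infinity>" by simp
    finally show ?thesis .
  qed
  have "(\<integral>\<^sup>+x. ?g x * indicator {..0} x \<partial>lborel) = (\<integral>\<^sup>+x. ?g x * indicator {0..} x \<partial>lborel)"
    by (subst nn_integral_real_affine[where c = "-1" and t = 0])
       (auto intro!: nn_integral_cong simp: indicator_def)
  moreover have "(\<integral>\<^sup>+x. ?g x \<partial>lborel) \<le> (\<integral>\<^sup>+x. ?g x * indicator {0..} x + ?g x * indicator {..0} x \<partial>lborel)"
    by (intro nn_integral_mono) (auto simp: indicator_def)
  moreover have "\<dots> = (\<integral>\<^sup>+x. ?g x * indicator {0..} x \<partial>lborel) + (\<integral>\<^sup>+x. ?g x * indicator {..0} x \<partial>lborel)"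
    by (rule nn_integral_add) auto
  ultimately show ?thesis using half by (simp add: le_less_trans ennreal_add_less_top)
qed

text \<open>
  As \<open>1 + (norm \<xi>)\<^sup>2\<close> dominates each \<open>1 + (\<xi> \<bullet> b)\<^sup>2\<close>, the integrand is at most a product of
  one-variable functions with exponent \<open>s / DIM('a) > 1 / 2\<close>.
\<close>

lemma nn_integral_japanese_bracket:
  fixes s :: real
  assumes s: "DIM('a) / 2 < s"
  shows "(\<integral>\<^sup>+\<xi>. ennreal ((1 + (norm (\<xi>::'a::euclidean_space))\<^sup>2) powr (- s)) \<partial>lborel) < \<infinity>"
proof -
  define p where "p = s / DIM('a)"
  have p: "1 / 2 < p" "s = p * DIM('a)" using s by (simp_all add: p_def field_simps)
  have "(\<integral>\<^sup>+\<xi>. ennreal ((1 + (norm (\<xi>::'a))\<^sup>2) powr (- s)) \<partial>lborel)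
      \<le> (\<integral>\<^sup>+\<xi>. (\<Prod>b\<in>Basis. ennreal ((1 + ((\<xi>::'a) \<bullet> b)\<^sup>2) powr (- p))) \<partial>lborel)"
  proof (intro nn_integral_mono)
    fix \<xi> :: 'a
    have pos: "0 < 1 + (norm \<xi>)\<^sup>2" by (simp add: add_pos_nonneg)
    have "(1 + (norm \<xi>)\<^sup>2) powr (- s) = (\<Prod>b\<in>(Basis::'a set). (1 + (norm \<xi>)\<^sup>2) powr (- p))"
      using pos by (simp add: p(2) powr_realpow[symmetric] powr_powr)
    also have "\<dots> \<le> (\<Prod>b\<in>(Basis::'a set). (1 + (\<xi> \<bullet> b)\<^sup>2) powr (- p))"
    proof (intro prod_mono conjI powr_mono2')
      fix b :: 'a assume "b \<in> Basis"
      then have "\<bar>\<xi> \<bullet> b\<bar> \<le> norm \<xi>" by (rule Basis_le_norm)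
      then show "1 + (\<xi> \<bullet> b)\<^sup>2 \<le> 1 + (norm \<xi>)\<^sup>2" by (simp add: abs_le_square_iff[symmetric])
      show "0 < 1 + (\<xi> \<bullet> b)\<^sup>2" by (simp add: add_pos_nonneg)
    qed (use p in auto)
    finally show "ennreal ((1 + (norm \<xi>)\<^sup>2) powr (- s)) \<le> (\<Prod>b\<in>Basis. ennreal ((1 + (\<xi> \<bullet> b)\<^sup>2) powr (- p)))"
      by (simp add: prod_ennreal ennreal_leI)
  qed
  also have "\<dots> = (\<Prod>b\<in>(Basis::'a set). \<integral>\<^sup>+x. ennreal ((1 + x\<^sup>2) powr (- p)) \<partial>lborel)"
    by (rule nn_integral_lborel_prod) auto
  also have "\<dots> < \<infinity>"
    using nn_integral_japanese_bracket_real[OF p(1)] by (simp add: power_less_top_ennreal)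
  finally show ?thesis .
qed

text \<open>
  The logarithm is concave: its tangent of slope \<open>k / s\<close> bounds \<open>s * ln (1 + r)\<close> by a constant plus
  \<open>k * r\<close>.
\<close>

lemma powr_le_exp:
  fixes s k :: real
  assumes "0 < s" "0 < k"
  obtains C where "0 \<le> C" "\<And>r. 0 \<le> r \<Longrightarrow> (1 + r) powr s \<le> C * exp (k * r)"
proof
  let ?c = "k / s"
  show "0 \<le> exp (k - s * ln ?c)" by simp
  fix r :: real assume r: "0 \<le> r"
  have "ln (?c * (1 + r)) \<le> ?c * (1 + r) - 1"
    using assms r by (intro ln_le_minus_one) auto
  then have "ln ?c + ln (1 + r) \<le> ?c * (1 + r)"
    using assms r ln_mult[of ?c "1 + r"] by simp
  then have "s * (ln ?c + ln (1 + r)) \<le> s * (?c * (1 + r))"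
    using assms by (intro mult_left_mono) auto
  moreover have "s * (?c * (1 + r)) = k + k * r"
    using assms by (simp add: distrib_left)
  ultimately have "s * ln (1 + r) \<le> k - s * ln ?c + k * r"
    by (simp add: distrib_left)
  then show "(1 + r) powr s \<le> exp (k - s * ln ?c) * exp (k * r)"
    using r by (simp add: powr_def exp_add[symmetric])
qed

lemma nn_integral_japanese_bracket_gaussian:
  fixes s k :: real
  assumes "0 < s" "0 < k"
  shows "(\<integral>\<^sup>+\<xi>. ennreal ((1 + (norm (\<xi>::'a::euclidean_space))\<^sup>2) powr s * exp (- k * (norm \<xi>)\<^sup>2)) \<partial>lborel) < \<infinity>"
proof -
  obtain C where C: "0 \<le> C" "\<And>r. 0 \<le> r \<Longrightarrow> (1 + r) powr s \<le> C * exp (k / 2 * r)"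
    using powr_le_exp[of s "k / 2"] assms by auto
  have "integrable lborel (\<lambda>\<xi>::'a. exp (- k * (norm \<xi>)\<^sup>2 / 2))"
    using gaussian_fourier[OF assms(2), of "0::'a"] by (simp add: has_bochner_integral_iff complex_of_real_integrable_eq)
  then have int: "(\<integral>\<^sup>+\<xi>. ennreal (C * exp (- k * (norm (\<xi>::'a))\<^sup>2 / 2)) \<partial>lborel) < \<infinity>"
    using C(1) by (simp add: integrable_iff_bounded ennreal_mult nn_integral_cmult ennreal_mult_less_top)
  have "(1 + (norm \<xi>)\<^sup>2) powr s * exp (- k * (norm \<xi>)\<^sup>2) \<le> C * exp (- k * (norm \<xi>)\<^sup>2 / 2)" for \<xi> :: 'a
  proof -
    have "(1 + (norm \<xi>)\<^sup>2) powr s * exp (- k * (norm \<xi>)\<^sup>2)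
        \<le> (C * exp (k / 2 * (norm \<xi>)\<^sup>2)) * exp (- k * (norm \<xi>)\<^sup>2)"
      using C by (intro mult_right_mono) auto
    also have "\<dots> = C * exp (- k * (norm \<xi>)\<^sup>2 / 2)"
      by (simp add: mult.assoc exp_add[symmetric])
    finally show ?thesis .
  qed
  then show ?thesis
    using int by (intro le_less_trans[OF nn_integral_mono int] ennreal_leI)
qed

section \<open>The smallest singular value\<close>

lemma inner_gram_matrix:
  fixes A :: "real^'n^'m"
  shows "((transpose A ** A) *v v) \<bullet> w = (A *v v) \<bullet> (A *v w)"
  by (simp add: matrix_vector_mul_assoc[symmetric] transpose_matrix_vector dot_lmul_matrix)

lemma norm_eq_sqrt_eigenvalue_of_gram_matrix:
  fixes A :: "real^'n^'m"
  assumes "(transpose A ** A) *v v = l *\<^sub>R v"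
  shows "norm (A *v v) = sqrt l * norm v"
proof -
  have "(norm (A *v v))\<^sup>2 = l * (norm v)\<^sup>2"
    using inner_gram_matrix[of A v v] assms by (simp add: power2_norm_eq_inner)
  then have "sqrt ((norm (A *v v))\<^sup>2) = sqrt (l * (norm v)\<^sup>2)" by simp
  then show ?thesis by (simp add: real_sqrt_mult)
qed

text \<open>
  Eigenvectors of the symmetric matrix \<open>transpose A ** A\<close> for distinct eigenvalues are orthogonal, hence
  independent. Finiteness matters because \<open>Min\<close> has no useful meaning on infinite sets.
\<close>

lemma finite_singular_values:
  fixes A :: "real^'d^'d"
  shows "finite (singular_values A)"
proof -
  define B where "B = transpose A ** A"
  define \<Lambda> where "\<Lambda> = {l. \<exists>v. v \<noteq> 0 \<and> B *v v = l *\<^sub>R v}"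
  obtain e where e: "\<And>l. l \<in> \<Lambda> \<Longrightarrow> e l \<noteq> 0 \<and> B *v e l = l *\<^sub>R e l"
    unfolding \<Lambda>_def by atomize (auto intro!: choice)
  have orth: "e l \<bullet> e k = 0" if "l \<in> \<Lambda>" "k \<in> \<Lambda>" "l \<noteq> k" for l k
  proof -
    have "l * (e l \<bullet> e k) = (B *v e l) \<bullet> e k" using e that by simp
    also have "\<dots> = (B *v e k) \<bullet> e l" unfolding B_def inner_gram_matrix by (rule inner_commute)
    also have "\<dots> = k * (e l \<bullet> e k)" using e that by (simp add: inner_commute)
    finally show ?thesis using that by simp
  qed
  have "inj_on e \<Lambda>"
    using orth e by (intro inj_onI) (metis inner_eq_zero_iff)
  moreover have "pairwise orthogonal (e ` \<Lambda>)"
    using orth by (auto simp: pairwise_def orthogonal_def)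
  then have "independent (e ` \<Lambda>)"
    using e by (intro pairwise_orthogonal_independent) auto
  then have "finite (e ` \<Lambda>)" by (rule independent_imp_finite)
  ultimately have "finite \<Lambda>" by (auto dest: finite_imageD)
  moreover have "singular_values A = sqrt ` \<Lambda>"
    unfolding singular_values_def \<Lambda>_def B_def by auto
  ultimately show ?thesis by simp
qed

text \<open>
  Let \<open>v0\<close> minimise \<open>norm (A *v v)\<close> on the unit sphere and let \<open>m\<close> be the square of the minimum. The
  quadratic form \<open>q\<close> of the proof is non-negative and vanishes at \<open>v0\<close>. Its derivative at \<open>v0\<close> in the
  direction \<open>u = (transpose A ** A) *v v0 - m *\<^sub>R v0\<close> is \<open>2 * (norm u)\<^sup>2\<close>, which must be 0. So \<open>v0\<close> is an
  eigenvector with eigenvalue \<open>m\<close>.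
\<close>

lemma minimal_stretch_in_singular_values:
  fixes A :: "real^'d^'d"
  obtains s where "s \<in> singular_values A" "\<And>v. s * norm v \<le> norm (A *v v)"
proof -
  have "\<exists>v\<in>sphere 0 1. \<forall>w\<in>sphere 0 1. norm (A *v v) \<le> norm (A *v w)"
    by (rule continuous_attains_inf) (auto intro!: continuous_intros matrix_vector_mult_linear_continuous_on)
  then obtain v0 where v0: "norm v0 = 1" and min: "\<And>w. norm w = 1 \<Longrightarrow> norm (A *v v0) \<le> norm (A *v w)"
    by auto
  define m where "m = (norm (A *v v0))\<^sup>2"
  have low: "norm (A *v v0) * norm v \<le> norm (A *v v)" for v
  proof (cases "v = 0")
    case False
    then have "norm (A *v v0) \<le> norm (A *v ((1 / norm v) *\<^sub>R v))" by (intro min) simp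
    also have "\<dots> = norm (A *v v) / norm v" by (simp add: matrix_vector_mult_scaleR)
    finally show ?thesis using False by (simp add: field_simps)
  qed simp
  define u where "u = (transpose A ** A) *v v0 - m *\<^sub>R v0"
  define q where "q = (\<lambda>v. (norm (A *v v))\<^sup>2 - m * (norm v)\<^sup>2)"
  have q: "0 \<le> q v" for v
    using power_mono[OF low[of v], of 2] by (simp add: q_def m_def power_mult_distrib)
  have expand: "q (v0 + t *\<^sub>R u) = 2 * t * (norm u)\<^sup>2 + t\<^sup>2 * q u" for t
  proof -
    have "q (v0 + t *\<^sub>R u) = q v0 + 2 * t * ((A *v v0) \<bullet> (A *v u) - m * (v0 \<bullet> u)) + t\<^sup>2 * q u"
      by (simp add: q_def power2_norm_eq_inner matrix_vector_right_distrib matrix_vector_mult_scaleR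
          inner_add_left inner_add_right inner_commute algebra_simps power2_eq_square[of t])
    moreover have "q v0 = 0" using v0 by (simp add: q_def m_def)
    moreover have "(A *v v0) \<bullet> (A *v u) - m * (v0 \<bullet> u) = u \<bullet> u"
      by (simp add: u_def inner_diff_left flip: inner_gram_matrix)
    ultimately show ?thesis by (simp add: power2_norm_eq_inner)
  qed
  have "u = 0"
  proof (rule ccontr)
    assume "u \<noteq> 0"
    \<comment> \<open>A step \<open>- t\<close> so small that the quadratic term cannot compensate the linear one.\<close>
    define t where "t = (norm u)\<^sup>2 / (q u + 1)"
    have t: "t > 0" using q[of u] \<open>u \<noteq> 0\<close> by (simp add: t_def)
    have "0 \<le> t * (t * q u - 2 * (norm u)\<^sup>2)"
      using q[of "v0 + (- t) *\<^sub>R u"] unfolding expand by (simp add: algebra_simps power2_eq_square)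
    then have "2 * (norm u)\<^sup>2 \<le> t * q u" using t by (simp add: zero_le_mult_iff)
    also have "\<dots> \<le> (norm u)\<^sup>2" using q[of u] by (simp add: t_def field_simps)
    finally show False using \<open>u \<noteq> 0\<close> by simp
  qed
  then have "(transpose A ** A) *v v0 = m *\<^sub>R v0" by (simp add: u_def)
  moreover have "v0 \<noteq> 0" using v0 by auto
  ultimately have "sqrt m \<in> singular_values A" unfolding singular_values_def by blast
  then show ?thesis using that low by (simp add: m_def)
qed

lemma smallest_singular_value_le:
  fixes A :: "real^'d^'d"
  shows "smallest_singular_value A * norm v \<le> norm (A *v v)"
proof -
  obtain s where s: "s \<in> singular_values A" "\<And>v. s * norm v \<le> norm (A *v v)"
    using minimal_stretch_in_singular_values[of A] by blast
  have "smallest_singular_value A \<le> s"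
    unfolding smallest_singular_value_def using finite_singular_values s(1) by (rule Min_le)
  with s(2)[of v] show ?thesis by (meson mult_right_mono norm_ge_zero order_trans)
qed

lemma smallest_singular_value_attained:
  fixes A :: "real^'d^'d"
  obtains v where "v \<noteq> 0" "norm (A *v v) = smallest_singular_value A * norm v"
proof -
  have "singular_values A \<noteq> {}"
    using minimal_stretch_in_singular_values[of A] by blast
  then have "smallest_singular_value A \<in> singular_values A"
    unfolding smallest_singular_value_def using finite_singular_values by (intro Min_in)
  then obtain l v where "smallest_singular_value A = sqrt l" "v \<noteq> 0" "(transpose A ** A) *v v = l *\<^sub>R v"
    unfolding singular_values_def by auto
  then show ?thesis
    using that[of v] norm_eq_sqrt_eigenvalue_of_gram_matrix[of A v l] by simp
qed

lemma smallest_singular_value_pos: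
  fixes A :: "real^'d^'d"
  assumes "invertible A"
  shows "0 < smallest_singular_value A"
proof -
  obtain v where v: "v \<noteq> 0" "norm (A *v v) = smallest_singular_value A * norm v"
    by (rule smallest_singular_value_attained)
  have "A *v v \<noteq> 0" using assms v(1) by (metis invertible_def matrix_left_invertible_ker)
  then have "0 < smallest_singular_value A * norm v" using v(2) by (metis zero_less_norm_iff)
  then show ?thesis using v(1) by (simp add: zero_less_mult_iff)
qed

lemma smallest_singular_value_le_onorm:
  fixes A :: "real^'d^'d"
  shows "smallest_singular_value A \<le> onorm (\<lambda>x. A *v x)"
proof -
  obtain v where v: "v \<noteq> 0" "norm (A *v v) = smallest_singular_value A * norm v"
    by (rule smallest_singular_value_attained)
  have "norm (A *v v) \<le> onorm (\<lambda>x. A *v x) * norm v"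
    by (rule onorm) (rule matrix_vector_mul_bounded_linear)
  with v show ?thesis by simp
qed

text \<open>
  With \<open>v = A *v u\<close> this follows by duality: \<open>(norm v)\<^sup>2 = (transpose A *v v) \<bullet> u\<close>, and \<open>norm u\<close> is at
  most \<open>norm v\<close> divided by the smallest singular value.
\<close>

lemma smallest_singular_value_le_transpose:
  fixes A :: "real^'d^'d"
  assumes "invertible A"
  shows "smallest_singular_value A * norm v \<le> norm (transpose A *v v)"
proof (cases "v = 0")
  case False
  obtain B where "A ** B = mat 1" using assms by (auto simp: invertible_def)
  define u where "u = B *v v"
  have u: "A *v u = v" by (simp add: u_def matrix_vector_mul_assoc \<open>A ** B = mat 1\<close>)
  let ?s = "smallest_singular_value A"
  have "(norm v)\<^sup>2 = (transpose A *v v) \<bullet> u"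
    using u by (simp add: power2_norm_eq_inner transpose_matrix_vector dot_lmul_matrix)
  also have "\<dots> \<le> norm (transpose A *v v) * norm u" by (rule norm_cauchy_schwarz)
  finally have "?s * (norm v)\<^sup>2 \<le> norm (transpose A *v v) * (?s * norm u)"
    using smallest_singular_value_pos[OF assms] by (simp add: mult_left_mono mult.left_commute)
  also have "\<dots> \<le> norm (transpose A *v v) * norm v"
    using smallest_singular_value_le[of A u] u by (simp add: mult_left_mono)
  finally show ?thesis using False by (simp add: power2_eq_square)
qed simp

lemma smallest_singular_value_conformal:
  fixes Q :: "real^'d^'d"
  assumes "orthogonal_matrix Q"
  shows "smallest_singular_value (c *\<^sub>R Q) = \<bar>c\<bar>"
proof -
  obtain v where v: "v \<noteq> 0" "norm ((c *\<^sub>R Q) *v v) = smallest_singular_value (c *\<^sub>R Q) * norm v"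
    by (rule smallest_singular_value_attained)
  have "orthogonal_transformation (\<lambda>x. Q *v x)"
    using assms by (simp add: orthogonal_transformation_matrix)
  then have "norm (Q *v v) = norm v" by (rule orthogonal_transformation_norm)
  then have "norm ((c *\<^sub>R Q) *v v) = \<bar>c\<bar> * norm v" by (simp add: scaleR_matrix_vector_assoc[symmetric])
  with v show ?thesis by simp
qed

lemma abs_det_conformal:
  fixes Q :: "real^'d^'d"
  assumes "orthogonal_matrix Q"
  shows "\<bar>det (c *\<^sub>R Q)\<bar> = \<bar>c\<bar> ^ CARD('d)"
proof -
  have "det (c *\<^sub>R Q) = c ^ CARD('d) * det Q"
  proof -
    have "c *\<^sub>R Q = (\<chi> i. c *s Q $ i)" by (simp add: vec_eq_iff)
    moreover have "Q = (\<chi> i. Q $ i)" by (simp add: vec_eq_iff)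
    ultimately show ?thesis
      using det_rows_mul[of "\<lambda>_. c" "\<lambda>i. Q $ i"] by simp
  qed
  moreover have "\<bar>det Q\<bar> = 1" using det_orthogonal_matrix[OF assms] by auto
  ultimately show ?thesis by (simp add: abs_mult power_abs)
qed

section \<open>Attractors of contractive iterated function systems\<close>

text \<open>
  The distance to \<open>L\<close> attains its maximum on \<open>K\<close> at some \<open>x = f i y\<close> with \<open>y \<in> K\<close>. As \<open>f i\<close> maps \<open>L\<close> into
  itself, the distance of \<open>x\<close> is at most \<open>\<rho>\<close> times the distance of \<open>y\<close>, so the maximum is 0.
\<close>

lemma contractive_ifs_invariant_subset:
  fixes f :: "'m \<Rightarrow> 'a::heine_borel \<Rightarrow> 'a"
  assumes contr: "\<And>i x y. dist (f i x) (f i y) \<le> \<rho> * dist x y" and "\<rho> < 1"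
    and K: "compact K" "K \<subseteq> (\<Union>i. f i ` K)"
    and L: "compact L" "L \<noteq> {}" "(\<Union>i. f i ` L) \<subseteq> L"
  shows "K \<subseteq> L"
proof (cases "K = {}")
  case False
  have "\<exists>x\<in>K. \<forall>y\<in>K. infdist y L \<le> infdist x L"
    using K(1) False by (intro continuous_attains_sup) (auto intro!: continuous_intros)
  then obtain x where x: "x \<in> K" and max: "\<And>y. y \<in> K \<Longrightarrow> infdist y L \<le> infdist x L" by blast
  obtain i y where y: "y \<in> K" "x = f i y" using x K(2) by blast
  obtain z where z: "z \<in> L" "infdist y L = dist y z"
    using infdist_attains_inf[of L y] L compact_imp_closed by blast
  have "infdist x L \<le> dist x (f i z)" using z L(3) by (intro infdist_le) auto
  also have "\<dots> \<le> \<rho> * infdist y L" using contr y(2) z(2) by simp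
  finally have le: "infdist x L \<le> \<rho> * infdist y L" .
  have "infdist x L = 0"
  proof (rule ccontr)
    assume "infdist x L \<noteq> 0"
    then have pos: "0 < infdist x L" by (simp add: infdist_nonneg less_le)
    have "\<rho> * infdist y L < infdist x L"
    proof (cases "0 < \<rho>")
      case True
      then have "\<rho> * infdist y L \<le> \<rho> * infdist x L" using max[OF y(1)] by simp
      also have "\<dots> < infdist x L" using \<open>\<rho> < 1\<close> pos by simp
      finally show ?thesis .
    next
      case False
      then have "\<rho> * infdist y L \<le> 0" by (simp add: mult_nonpos_nonneg infdist_nonneg)
      with pos show ?thesis by simp
    qed
    with le show False by simp
  qed
  have "y \<in> L" if "y \<in> K" for y
  proof -
    have "infdist y L = 0"
      using max[OF that] \<open>infdist x L = 0\<close> infdist_nonneg[of y L] by linarith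
    then show ?thesis
      using in_closed_iff_infdist_zero[OF compact_imp_closed[OF L(1)] L(2)] by blast
  qed
  then show ?thesis by blast
qed simp

text \<open>
  Uniqueness is the previous lemma applied in both directions. For existence, start from a ball that the
  maps send into itself and intersect its iterated images. A point of the intersection has, for every
  \<open>n\<close>, a preimage in the \<open>n\<close>-th image under some \<open>f i\<close>. One index \<open>i\<close> serves infinitely many \<open>n\<close>, and
  compactness yields a preimage in the intersection.
\<close>

lemma contractive_ifs_unique_attractor:
  fixes f :: "'m::finite \<Rightarrow> 'a::euclidean_space \<Rightarrow> 'a"
  assumes contr: "\<And>i x y. dist (f i x) (f i y) \<le> \<rho> * dist x y" and \<rho>: "0 \<le> \<rho>" "\<rho> < 1"
  shows "\<exists>!K. K \<noteq> {} \<and> compact K \<and> K = (\<Union>i. f i ` K)"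
proof (rule ex_ex1I)
  fix K L
  assume "K \<noteq> {} \<and> compact K \<and> K = (\<Union>i. f i ` K)" "L \<noteq> {} \<and> compact L \<and> L = (\<Union>i. f i ` L)"
  then show "K = L"
    using contractive_ifs_invariant_subset[of f \<rho> K L] contractive_ifs_invariant_subset[of f \<rho> L K] contr \<rho>
    by (metis order_antisym order_refl)
next
  define F where "F = (\<lambda>X. \<Union>i. f i ` X)"
  define R where "R = (\<Sum>i\<in>UNIV. norm (f i 0)) / (1 - \<rho>)"
  define B where "B = (\<lambda>n. (F ^^ n) (cball 0 R))"
  have "0 \<le> R" unfolding R_def using \<rho> by (intro divide_nonneg_nonneg sum_nonneg) auto
  have mono: "F X \<subseteq> F Y" if "X \<subseteq> Y" for X Y using that by (auto simp: F_def)
  have cont: "continuous_on X (f i)" for X i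
    by (rule lipschitz_on_continuous_on[where L = \<rho>]) (auto simp: lipschitz_on_def contr \<rho>)
  have "F (cball 0 R) \<subseteq> cball 0 R"
  proof -
    have "norm (f i x) \<le> R" if "norm x \<le> R" for i x
    proof -
      have "norm (f i x) \<le> norm (f i 0) + dist (f i x) (f i 0)"
        by (metis add.commute dist_norm norm_triangle_sub)
      also have "norm (f i 0) \<le> (\<Sum>i\<in>UNIV. norm (f i 0))" by (intro member_le_sum) auto
      also have "\<dots> = (1 - \<rho>) * R" using \<rho> by (simp add: R_def)
      also have "dist (f i x) (f i 0) \<le> \<rho> * R"
        using contr[of i x 0] that \<rho> by (simp add: mult_left_mono order_trans)
      finally show ?thesis by (simp add: algebra_simps)
    qed
    then show ?thesis by (auto simp: F_def)
  qed
  then have dec: "B (Suc n) \<subseteq> B n" for n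
    by (induction n) (auto simp: B_def dest: mono)
  then have anti: "B n \<subseteq> B m" if "m \<le> n" for m n using lift_Suc_antimono_le that by metis
  have comp: "compact (B n)" for n
  proof (induction n)
    case (Suc n)
    then show ?case
      by (auto simp: B_def F_def intro!: compact_UN compact_continuous_image cont)
  qed (simp add: B_def)
  have ne: "B n \<noteq> {}" for n
    using \<open>0 \<le> R\<close> by (induction n) (auto simp: B_def F_def)
  define K where "K = (\<Inter>n. B n)"
  have "K \<noteq> {}" unfolding K_def using comp ne anti by (intro compact_nest) auto
  moreover have "compact K" unfolding K_def using comp by (intro compact_Inter) auto
  moreover have "F K \<subseteq> K"
  proof -
    have "F K \<subseteq> B (Suc n)" for n using mono[of K "B n"] by (auto simp: K_def B_def)
    then show ?thesis unfolding K_def using dec by blast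
  qed
  moreover have "K \<subseteq> F K"
  proof
    fix x assume "x \<in> K"
    have "\<forall>n. \<exists>i. x \<in> f i ` B n"
    proof
      fix n
      have "x \<in> B (Suc n)" using \<open>x \<in> K\<close> by (simp add: K_def)
      then show "\<exists>i. x \<in> f i ` B n" by (simp add: B_def F_def)
    qed
    then obtain c where c: "\<And>n. x \<in> f (c n) ` B n" by metis
    obtain i where i: "infinite {n. c n = i}"
      using pigeonhole_infinite[of UNIV c] by auto
    have pre: "x \<in> f i ` B n" for n
    proof -
      obtain k where "n \<le> k" "c k = i"
        using i unfolding infinite_nat_iff_unbounded_le by auto
      then show ?thesis using c[of k] anti[of n k] by auto
    qed
    have "(\<Inter>n. B n \<inter> f i -` {x}) \<noteq> {}"
    proof (rule compact_nest)
      have "closed (B n \<inter> f i -` {x})" for n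
        using cont comp by (intro continuous_closed_preimage) (auto simp: compact_imp_closed)
      then show "compact (B n \<inter> f i -` {x})" for n
        using compact_Int_closed[OF comp[of n]] by (metis inf.left_idem)
    qed (use pre anti in auto)
    then show "x \<in> F K" by (auto simp: K_def F_def)
  qed
  ultimately show "\<exists>K. K \<noteq> {} \<and> compact K \<and> K = (\<Union>i. f i ` K)"
    unfolding F_def by blast
qed

lemma self_affine_set_attractor:
  fixes T :: "'m::finite \<Rightarrow> real^'d^'d"
  assumes "\<And>i x. norm (T i *v x) \<le> \<rho> * norm x" "0 \<le> \<rho>" "\<rho> < 1"
  shows "self_affine_set T a \<noteq> {}" "compact (self_affine_set T a)"
    "self_affine_set T a = (\<Union>i. (\<lambda>x. T i *v x + a $ i) ` self_affine_set T a)"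
proof -
  have "\<exists>!K. K \<noteq> {} \<and> compact K \<and> K = (\<Union>i. (\<lambda>x. T i *v x + a $ i) ` K)"
    using assms by (intro contractive_ifs_unique_attractor[where \<rho> = \<rho>])
      (simp_all add: dist_norm matrix_vector_mult_diff_distrib[symmetric])
  note K = theI'[OF this, folded self_affine_set_def]
  show "self_affine_set T a \<noteq> {}" by (rule K[THEN conjunct1])
  show "compact (self_affine_set T a)" by (rule K[THEN conjunct2, THEN conjunct1])
  show "self_affine_set T a = (\<Union>i. (\<lambda>x. T i *v x + a $ i) ` self_affine_set T a)"
    by (rule K[THEN conjunct2, THEN conjunct2])
qed

section \<open>Self-affine measures with random translations\<close>

definition words :: "nat \<Rightarrow> 'm list set" where
  "words n = {I. length I = n}"

lemma words_0: "words 0 = {[]}"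
  by (auto simp: words_def)

lemma finite_words [simp]: "finite (words n :: 'm::finite list set)"
  using finite_lists_length_eq[of "UNIV :: 'm set" n] by (simp add: words_def)

lemma sum_words_Suc: "(\<Sum>I\<in>words (Suc n). F I) = (\<Sum>i\<in>UNIV. \<Sum>I\<in>words n. F (i # I))"
  for F :: "'m::finite list \<Rightarrow> 'b::comm_monoid_add"
proof -
  have "words (Suc n) = (\<lambda>(i, I). i # I) ` (UNIV \<times> (words n :: 'm list set))"
    by (auto simp: words_def length_Suc_conv)
  moreover have "inj_on (\<lambda>(i, I). i # I) (UNIV \<times> (words n :: 'm list set))"
    by (auto simp: inj_on_def)
  ultimately show ?thesis
    by (simp add: sum.reindex sum.cartesian_product o_def case_prod_unfold)
qed

lemma norm_transpose_le:
  fixes A :: "real^'n^'m"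
  assumes "0 \<le> r" "\<And>x. norm (A *v x) \<le> r * norm x"
  shows "norm (transpose A *v y) \<le> r * norm y"
proof -
  let ?z = "transpose A *v y"
  have "norm ?z * norm ?z = ?z \<bullet> ?z"
    by (simp add: power2_norm_eq_inner flip: power2_eq_square)
  also have "\<dots> = y \<bullet> (A *v ?z)"
    unfolding transpose_matrix_vector by (rule dot_lmul_matrix)
  also have "\<dots> \<le> norm y * norm (A *v ?z)" by (rule norm_cauchy_schwarz)
  also have "\<dots> \<le> norm y * (r * norm ?z)" by (intro mult_left_mono assms) auto
  finally have "norm ?z * norm ?z \<le> (r * norm y) * norm ?z" by (simp add: mult_ac)
  then show ?thesis
    using assms(1) by (cases "norm ?z = 0") (auto intro: mult_right_le_imp_le)
qed

text \<open>
  Throughout this part \<open>point I a\<close> is the image of 0 under the composition of the maps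
  \<open>x \<mapsto> T i *v x + a $ i\<close> along the word \<open>I\<close>, and \<open>weight I\<close> is the probability of \<open>I\<close> when the letters are
  drawn independently with probabilities \<open>p\<close>.
\<close>

locale weighted_affine_ifs =
  fixes T :: "'m::finite \<Rightarrow> real^'d^'d" and p :: "'m \<Rightarrow> real" and \<rho> :: real
  assumes T_le: "norm (T i *v x) \<le> \<rho> * norm x"
    and \<rho>_nonneg: "0 \<le> \<rho>" and \<rho>_less: "\<rho> < 1 / 2"
    and p_nonneg: "0 \<le> p i" and p_sum: "(\<Sum>i\<in>UNIV. p i) = 1"
begin

primrec point :: "'m list \<Rightarrow> (real^'d)^'m \<Rightarrow> real^'d" where
  "point [] a = 0"
| "point (i # I) a = a $ i + T i *v point I a"

primrec weight :: "'m list \<Rightarrow> real" where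
  "weight [] = 1"
| "weight (i # I) = p i * weight I"

lemma weight_nonneg: "0 \<le> weight I"
  by (induction I) (auto simp: p_nonneg)

lemma sum_weight: "(\<Sum>I\<in>words n. weight I) = 1"
  by (induction n) (simp_all add: words_0 sum_words_Suc sum_distrib_left[symmetric] p_sum)

lemma linear_point: "linear (point I)"
proof (induction I)
  case (Cons i I)
  have "linear (\<lambda>a. a $ i + T i *v point I a)"
    by (intro linear_compose_add linear_compose[OF Cons, unfolded o_def] matrix_vector_mul_linear
        bounded_linear.linear[OF bounded_linear_vec_nth])
  then show ?case by (simp add: fun_eq_iff[symmetric])
qed (simp add: linear_zero)

lemma borel_measurable_point [measurable]: "point I \<in> borel_measurable borel"
  by (intro borel_measurable_continuous_onI linear_continuous_on linear_conv_bounded_linear[THEN iffD1] linear_point)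

lemma norm_point_le:
  assumes "\<And>i. norm (a $ i) \<le> M"
  shows "norm (point I a) \<le> 2 * M"
proof (induction I)
  case Nil
  have "0 \<le> M" using assms[of undefined] norm_ge_zero order_trans by blast
  then show ?case by simp
next
  case (Cons i I)
  have "norm (point (i # I) a) \<le> norm (a $ i) + \<rho> * norm (point I a)"
    using norm_triangle_ineq[of "a $ i" "T i *v point I a"] T_le[of i "point I a"] by simp
  also have "\<dots> \<le> M + 1 / 2 * (2 * M)"
    using Cons \<rho>_less \<rho>_nonneg assms by (intro add_mono mult_mono) auto
  finally show ?case by simp
qed

lemma point_near_attractor:
  assumes inv: "\<And>i x. x \<in> K \<Longrightarrow> T i *v x + a $ i \<in> K" and "z \<in> K"
  shows "\<exists>y\<in>K. dist (point I a) y \<le> \<rho> ^ length I * norm z"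
proof (induction I)
  case Nil
  then show ?case using \<open>z \<in> K\<close> by (intro bexI[of _ z]) auto
next
  case (Cons i I)
  then obtain y where y: "y \<in> K" "dist (point I a) y \<le> \<rho> ^ length I * norm z" by blast
  have "dist (point (i # I) a) (T i *v y + a $ i) = norm (T i *v (point I a - y))"
    by (simp add: dist_norm matrix_vector_mult_diff_distrib)
  also have "\<dots> \<le> \<rho> * (\<rho> ^ length I * norm z)"
    using y(2) \<rho>_nonneg unfolding dist_norm by (intro order_trans[OF T_le] mult_left_mono)
  finally show ?case using inv[OF y(1)] by (auto simp: mult.assoc)
qed

text \<open>
  This is the mean of \<open>cis (\<xi> \<bullet> (point I a - point J a))\<close> for a standard Gaussian vector \<open>a\<close>.
\<close>

definition overlap :: "'m list \<Rightarrow> 'm list \<Rightarrow> real^'d \<Rightarrow> real" where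
  "overlap I J \<xi> = exp (- (norm (adjoint (\<lambda>a. point I a - point J a) \<xi>))\<^sup>2 / 2)"

definition \<kappa> :: real where "\<kappa> = (1 - 2 * \<rho>)\<^sup>2"

lemma \<kappa>_pos: "0 < \<kappa>"
  using \<rho>_less by (simp add: \<kappa>_def)

lemma linear_point_diff: "linear (\<lambda>a. point I a - point J a)"
  by (intro linear_compose_sub linear_point)

text \<open>
  Transversality. Test the adjoint against the vector \<open>a\<close> with entry \<open>\<xi>\<close> at \<open>i\<close>, entry \<open>- \<xi>\<close> at \<open>j\<close>
  and 0 elsewhere. The first letters contribute \<open>2 * (norm \<xi>)\<^sup>2\<close> to
  \<open>\<xi> \<bullet> (point (i # I) a - point (j # J) a)\<close>. The remaining letters contribute at most
  \<open>4 * \<rho> * (norm \<xi>)\<^sup>2\<close> in absolute value, because translations of norm at most \<open>norm \<xi>\<close> produce points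
  of norm at most \<open>2 * norm \<xi>\<close>. This leaves a positive multiple of \<open>(norm \<xi>)\<^sup>2\<close> precisely when \<open>\<rho> < 1 / 2\<close>.
\<close>

lemma overlap_distinct:
  assumes "i \<noteq> j"
  shows "overlap (i # I) (j # J) \<xi> \<le> exp (- \<kappa> * (norm \<xi>)\<^sup>2)"
proof -
  define L where "L = (\<lambda>a. point (i # I) a - point (j # J) a)"
  define a :: "(real^'d)^'m" where "a = (\<chi> l. if l = i then \<xi> else if l = j then - \<xi> else 0)"
  have a: "a $ i = \<xi>" "a $ j = - \<xi>" "\<And>l. norm (a $ l) \<le> norm \<xi>"
    using assms by (auto simp: a_def)
  have "a \<bullet> a = (\<Sum>l\<in>{i, j}. (a $ l) \<bullet> (a $ l))"
    unfolding inner_vec_def by (rule sum.mono_neutral_right) (auto simp: a_def)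
  then have norm_a: "norm a = sqrt 2 * norm \<xi>"
    using assms a by (simp add: norm_eq_sqrt_inner real_sqrt_mult[symmetric])
  have pt: "\<bar>\<xi> \<bullet> (T l *v point I' a)\<bar> \<le> 2 * \<rho> * (norm \<xi>)\<^sup>2" for l I'
  proof -
    have "\<bar>\<xi> \<bullet> (T l *v point I' a)\<bar> \<le> norm \<xi> * norm (T l *v point I' a)" by (rule Cauchy_Schwarz_ineq2)
    also have "\<dots> \<le> norm \<xi> * (\<rho> * (2 * norm \<xi>))"
      using \<rho>_nonneg by (intro mult_left_mono order_trans[OF T_le] norm_point_le a(3)) auto
    finally show ?thesis by (simp add: power2_eq_square mult_ac)
  qed
  have "2 * (1 - 2 * \<rho>) * (norm \<xi>)\<^sup>2 \<le> \<xi> \<bullet> L a"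
  proof -
    have "\<xi> \<bullet> L a = 2 * (norm \<xi>)\<^sup>2 + \<xi> \<bullet> (T i *v point I a) - \<xi> \<bullet> (T j *v point J a)"
      unfolding L_def point.simps a inner_diff_right inner_add_right inner_minus_right power2_norm_eq_inner
      by simp
    then show ?thesis using pt[of i I] pt[of j J] by (simp add: algebra_simps)
  qed
  also have "\<xi> \<bullet> L a = a \<bullet> adjoint L \<xi>"
    using adjoint_works[of L a \<xi>] linear_point_diff[of "i # I" "j # J"] by (simp add: L_def inner_commute)
  also have "\<dots> \<le> norm a * norm (adjoint L \<xi>)" by (rule norm_cauchy_schwarz)
  finally have "2 * (1 - 2 * \<rho>) * norm \<xi> * norm \<xi> \<le> sqrt 2 * norm (adjoint L \<xi>) * norm \<xi>"
    by (simp add: norm_a power2_eq_square mult_ac)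
  then have "2 * (1 - 2 * \<rho>) * norm \<xi> \<le> sqrt 2 * norm (adjoint L \<xi>)"
    by (cases "\<xi> = 0") auto
  then have "(2 * (1 - 2 * \<rho>) * norm \<xi>)\<^sup>2 \<le> (sqrt 2 * norm (adjoint L \<xi>))\<^sup>2"
    using \<rho>_less by (intro power_mono) auto
  then have "\<kappa> * (norm \<xi>)\<^sup>2 \<le> (norm (adjoint L \<xi>))\<^sup>2 / 2"
    unfolding power_mult_distrib \<kappa>_def[symmetric] by simp
  then show ?thesis by (simp add: overlap_def L_def)
qed

lemma overlap_Cons:
  "overlap (i # I) (i # J) \<xi> = overlap I J (transpose (T i) *v \<xi>)"
proof -
  have "a \<bullet> adjoint (\<lambda>a. point (i # I) a - point (i # J) a) \<xi>
      = a \<bullet> adjoint (\<lambda>a. point I a - point J a) (transpose (T i) *v \<xi>)" for a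
  proof -
    have "a \<bullet> adjoint (\<lambda>a. point (i # I) a - point (i # J) a) \<xi> = (point (i # I) a - point (i # J) a) \<bullet> \<xi>"
      using adjoint_works[OF linear_point_diff] by blast
    also have "\<dots> = (point I a - point J a) \<bullet> (transpose (T i) *v \<xi>)"
      by (simp add: matrix_vector_mult_diff_distrib[symmetric] transpose_matrix_vector inner_commute[of _ "\<xi> v* T i"] dot_lmul_matrix)
         (simp add: inner_commute)
    also have "\<dots> = a \<bullet> adjoint (\<lambda>a. point I a - point J a) (transpose (T i) *v \<xi>)"
      by (rule adjoint_works[OF linear_point_diff, symmetric])
    finally show ?thesis .
  qed
  then have "adjoint (\<lambda>a. point (i # I) a - point (i # J) a) \<xi>
      = adjoint (\<lambda>a. point I a - point J a) (transpose (T i) *v \<xi>)"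
    using vector_eq_ldot by blast
  then show ?thesis by (simp add: overlap_def)
qed

text \<open>
  Up to a constant factor, \<open>pair_energy n \<xi>\<close> is the Gaussian mean of the squared modulus of the \<open>n\<close>-th
  Fourier transform at \<open>\<xi>\<close>.
\<close>

definition pair_energy :: "nat \<Rightarrow> real^'d \<Rightarrow> real" where
  "pair_energy n \<xi> = (\<Sum>I\<in>words n. \<Sum>J\<in>words n. weight I * weight J * overlap I J \<xi>)"

text \<open>
  Unfolded, this is the sum over all words \<open>u\<close> of length below \<open>n\<close> of \<open>(weight u)\<^sup>2\<close> times
  \<open>exp (- \<kappa> * (norm \<eta>)\<^sup>2)\<close>, where \<open>\<eta>\<close> is the image of \<open>\<xi>\<close> under the transposed matrix product along \<open>u\<close>;
  the word \<open>u\<close> is the common prefix of two words. The recursive form matches the self-similarity of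
  \<open>pair_energy\<close>.
\<close>

primrec energy_bound :: "nat \<Rightarrow> real^'d \<Rightarrow> real" where
  "energy_bound 0 \<xi> = 0"
| "energy_bound (Suc n) \<xi> =
     exp (- \<kappa> * (norm \<xi>)\<^sup>2) + (\<Sum>i\<in>UNIV. (p i)\<^sup>2 * energy_bound n (transpose (T i) *v \<xi>))"

lemma energy_bound_nonneg: "0 \<le> energy_bound n \<xi>"
  by (induction n arbitrary: \<xi>) (auto intro!: add_nonneg_nonneg sum_nonneg)

lemma energy_bound_mono: "energy_bound n \<xi> \<le> energy_bound (Suc n) \<xi>"
proof (induction n arbitrary: \<xi>)
  case (Suc n)
  then show ?case
    unfolding energy_bound.simps(2)[of "Suc n"] energy_bound.simps(2)[of n]
    by (intro add_left_mono sum_mono mult_left_mono Suc) auto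
qed simp

lemma borel_measurable_energy_bound [measurable]: "energy_bound n \<in> borel_measurable borel"
proof (induction n)
  case (Suc n)
  note Suc[measurable]
  show ?case unfolding energy_bound.simps by measurable
qed (simp add: fun_eq_iff)

text \<open>
  Split pairs of words by their first letters. Distinct letters are controlled by transversality, equal
  letters reduce to words of length \<open>n\<close> with \<open>\<xi>\<close> replaced by its image under the transposed matrix. The
  last term on the right is the contribution of the pairs of equal words, which show no decay in \<open>\<xi>\<close>.
\<close>

lemma pair_energy_le: "pair_energy n \<xi> \<le> energy_bound n \<xi> + (\<Sum>i\<in>UNIV. (p i)\<^sup>2) ^ n"
proof (induction n arbitrary: \<xi>)
  case 0
  then show ?case by (simp add: pair_energy_def words_0 overlap_def)
next
  case (Suc n)
  let ?q = "\<Sum>i\<in>UNIV. (p i)\<^sup>2" and ?g = "exp (- \<kappa> * (norm \<xi>)\<^sup>2)"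
  let ?X = "\<lambda>i j. \<Sum>I\<in>words n. \<Sum>J\<in>words n. weight I * weight J * overlap (i # I) (j # J) \<xi>"
  have X: "?X i j \<le> ?g + (if i = j then pair_energy n (transpose (T i) *v \<xi>) else 0)" for i j
  proof (cases "i = j")
    case True
    then show ?thesis by (simp add: overlap_Cons pair_energy_def)
  next
    case False
    have "?X i j \<le> (\<Sum>I\<in>words n. \<Sum>J\<in>words n. weight I * weight J * ?g)"
      using False by (intro sum_mono mult_left_mono overlap_distinct mult_nonneg_nonneg weight_nonneg)
    also have "\<dots> = ?g"
      by (simp add: sum_distrib_left[symmetric] sum_distrib_right[symmetric] sum_weight)
    finally show ?thesis using False by simp
  qed
  have "pair_energy (Suc n) \<xi> = (\<Sum>i\<in>UNIV. \<Sum>j\<in>UNIV. p i * p j * ?X i j)"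
    unfolding pair_energy_def sum_words_Suc
    by (subst sum.swap) (simp add: sum_distrib_left mult_ac)
  also have "\<dots> \<le> (\<Sum>i\<in>UNIV. \<Sum>j\<in>UNIV. p i * p j * (?g + (if i = j then pair_energy n (transpose (T i) *v \<xi>) else 0)))"
    by (intro sum_mono mult_left_mono X mult_nonneg_nonneg p_nonneg)
  also have "\<dots> = (\<Sum>i\<in>UNIV. \<Sum>j\<in>UNIV. p i * p j * ?g) + (\<Sum>i\<in>UNIV. (p i)\<^sup>2 * pair_energy n (transpose (T i) *v \<xi>))"
    by (simp add: distrib_left sum.distrib if_distrib[of "\<lambda>x. _ * x"] power2_eq_square cong: if_cong)
  also have "(\<Sum>i\<in>UNIV. \<Sum>j\<in>UNIV. p i * p j * ?g) = ?g"
    by (simp add: sum_distrib_left[symmetric] sum_distrib_right[symmetric] p_sum)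
  also have "(\<Sum>i\<in>UNIV. (p i)\<^sup>2 * pair_energy n (transpose (T i) *v \<xi>))
      \<le> (\<Sum>i\<in>UNIV. (p i)\<^sup>2 * (energy_bound n (transpose (T i) *v \<xi>) + ?q ^ n))"
    by (intro sum_mono mult_left_mono Suc) auto
  also have "\<dots> = (\<Sum>i\<in>UNIV. (p i)\<^sup>2 * energy_bound n (transpose (T i) *v \<xi>)) + ?q ^ Suc n"
    by (simp add: distrib_left sum.distrib sum_distrib_right)
  finally show ?case by simp
qed

definition charfun :: "nat \<Rightarrow> (real^'d)^'m \<Rightarrow> real^'d \<Rightarrow> complex" where
  "charfun n a \<xi> = (\<Sum>I\<in>words n. weight I *\<^sub>R cis (\<xi> \<bullet> point I a))"

lemma borel_measurable_charfun [measurable]: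
  "(\<lambda>(a, \<xi>). charfun n a \<xi>) \<in> borel_measurable (lborel \<Otimes>\<^sub>M lborel)"
  unfolding charfun_def by measurable

lemma charfun_Suc:
  "charfun (Suc n) a \<xi> = (\<Sum>i\<in>UNIV. p i *\<^sub>R (cis (\<xi> \<bullet> a $ i) * charfun n a (transpose (T i) *v \<xi>)))"
proof -
  have "\<xi> \<bullet> (T i *v x) = (transpose (T i) *v \<xi>) \<bullet> x" for i x
    by (simp add: transpose_matrix_vector dot_lmul_matrix)
  then show ?thesis
    by (simp add: charfun_def sum_words_Suc inner_add_right cis_mult[symmetric] scaleR_sum_right sum_distrib_left)
qed

text \<open>
  Lengthening all words by one letter moves each point by at most \<open>\<rho> ^ n * norm a\<close>. The induction
  prepends the letter, so that the contraction shows up in the argument \<open>transpose (T i) *v \<xi>\<close>.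
\<close>

lemma norm_charfun_diff_le:
  "norm (charfun (Suc n) a \<xi> - charfun n a \<xi>) \<le> \<rho> ^ n * (norm \<xi> * norm a)"
proof (induction n arbitrary: \<xi>)
  case 0
  have "charfun (Suc 0) a \<xi> - charfun 0 a \<xi> = (\<Sum>i\<in>UNIV. p i *\<^sub>R (cis (\<xi> \<bullet> a $ i) - 1))"
  proof -
    have "(\<Sum>i\<in>UNIV. complex_of_real (p i)) = 1" using p_sum by (metis of_real_1 of_real_sum)
    moreover have "charfun 0 a \<eta> = 1" for \<eta> by (simp add: charfun_def words_0)
    ultimately show ?thesis
      unfolding charfun_Suc by (simp add: right_diff_distrib sum_subtractf scaleR_conv_of_real)
  qed
  also have "norm \<dots> \<le> (\<Sum>i\<in>UNIV. p i * (norm \<xi> * norm a))"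
  proof (rule sum_norm_le)
    fix i
    have "norm (cis (\<xi> \<bullet> a $ i) - 1) \<le> \<bar>\<xi> \<bullet> a $ i\<bar>"
      using iexp_approx1[of "\<xi> \<bullet> a $ i" 0] by (simp add: cis_conv_exp)
    also have "\<dots> \<le> norm \<xi> * norm (a $ i)" by (rule Cauchy_Schwarz_ineq2)
    also have "\<dots> \<le> norm \<xi> * norm a" by (intro mult_left_mono Finite_Cartesian_Product.norm_nth_le) auto
    finally show "norm (p i *\<^sub>R (cis (\<xi> \<bullet> a $ i) - 1)) \<le> p i * (norm \<xi> * norm a)"
      by (simp add: p_nonneg mult_left_mono)
  qed
  also have "\<dots> = norm \<xi> * norm a" by (simp add: sum_distrib_right[symmetric] p_sum)
  finally show ?case by simp
next
  case (Suc n)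
  let ?S = "\<lambda>i. transpose (T i) *v \<xi>"
  have "charfun (Suc (Suc n)) a \<xi> - charfun (Suc n) a \<xi>
      = (\<Sum>i\<in>UNIV. p i *\<^sub>R (cis (\<xi> \<bullet> a $ i) * (charfun (Suc n) a (?S i) - charfun n a (?S i))))"
    unfolding charfun_Suc[of "Suc n"] charfun_Suc[of n]
    by (simp add: sum_subtractf right_diff_distrib scaleR_diff_right)
  also have "norm \<dots> \<le> (\<Sum>i\<in>UNIV. p i * (\<rho> ^ Suc n * (norm \<xi> * norm a)))"
  proof (rule sum_norm_le)
    fix i
    have "norm (charfun (Suc n) a (?S i) - charfun n a (?S i)) \<le> \<rho> ^ n * (norm (?S i) * norm a)"
      by (rule Suc)
    also have "\<dots> \<le> \<rho> ^ n * ((\<rho> * norm \<xi>) * norm a)"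
      using \<rho>_nonneg T_le by (intro mult_left_mono mult_right_mono norm_transpose_le) auto
    finally have "p i * norm (charfun (Suc n) a (?S i) - charfun n a (?S i)) \<le> p i * (\<rho> ^ n * ((\<rho> * norm \<xi>) * norm a))"
      by (rule mult_left_mono) (rule p_nonneg)
    then show "norm (p i *\<^sub>R (cis (\<xi> \<bullet> a $ i) * (charfun (Suc n) a (?S i) - charfun n a (?S i))))
        \<le> p i * (\<rho> ^ Suc n * (norm \<xi> * norm a))"
      by (simp add: norm_mult p_nonneg mult_ac)
  qed
  also have "\<dots> = \<rho> ^ Suc n * (norm \<xi> * norm a)" by (simp add: sum_distrib_right[symmetric] p_sum)
  finally show ?case .
qed

definition limit_charfun :: "(real^'d)^'m \<Rightarrow> real^'d \<Rightarrow> complex" where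
  "limit_charfun a \<xi> = lim (\<lambda>n. charfun n a \<xi>)"

lemma charfun_tendsto: "(\<lambda>n. charfun n a \<xi>) \<longlonglongrightarrow> limit_charfun a \<xi>"
proof -
  have "summable (\<lambda>n. charfun (Suc n) a \<xi> - charfun n a \<xi>)"
  proof (rule summable_comparison_test')
    show "summable (\<lambda>n. \<rho> ^ n * (norm \<xi> * norm a))"
      using \<rho>_nonneg \<rho>_less by (intro summable_mult2 summable_geometric) auto
    show "norm (charfun (Suc n) a \<xi> - charfun n a \<xi>) \<le> \<rho> ^ n * (norm \<xi> * norm a)" for n
      by (rule norm_charfun_diff_le)
  qed
  then have "convergent (\<lambda>n. \<Sum>k<n. charfun (Suc k) a \<xi> - charfun k a \<xi>)"
    by (simp add: summable_iff_convergent)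
  then have "convergent (\<lambda>n. charfun n a \<xi> - charfun 0 a \<xi>)"
    unfolding sum_lessThan_telescope[of "\<lambda>n. charfun n a \<xi>"] .
  then have "convergent (\<lambda>n. charfun n a \<xi>)"
    using convergent_add_const_right_iff[of "\<lambda>n. charfun n a \<xi>" "- charfun 0 a \<xi>"] by simp
  then show ?thesis by (simp add: limit_charfun_def convergent_LIMSEQ_iff)
qed

lemma borel_measurable_limit_charfun [measurable]:
  "(\<lambda>(a, \<xi>). limit_charfun a \<xi>) \<in> borel_measurable (lborel \<Otimes>\<^sub>M lborel)"
  by (rule borel_measurable_LIMSEQ_metric[where f = "\<lambda>n (a, \<xi>). charfun n a \<xi>"])
     (auto simp: charfun_tendsto)

text \<open>
  Expand the squared modulus into a double sum over words. In each summand the phase is the inner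
  product of \<open>a\<close> with a fixed vector, the value of an adjoint map at \<open>\<xi>\<close>.
\<close>

lemma gaussian_mean_square_charfun:
  "has_bochner_integral lborel (\<lambda>a. exp (- (norm a)\<^sup>2 / 2) * (norm (charfun n a \<xi>))\<^sup>2)
     (sqrt (2 * pi) ^ DIM((real^'d)^'m) * pair_energy n \<xi>)"
proof -
  let ?L = "\<lambda>I J. adjoint (\<lambda>a. point I a - point J a) \<xi>"
  have "has_bochner_integral lborel
      (\<lambda>a. \<Sum>I\<in>words n. \<Sum>J\<in>words n. (weight I * weight J) *\<^sub>R
          (cis (?L I J \<bullet> a) * complex_of_real (exp (- 1 * (norm a)\<^sup>2 / 2))))
      (\<Sum>I\<in>words n. \<Sum>J\<in>words n. (weight I * weight J) *\<^sub>R
          complex_of_real (sqrt (2 * pi / 1) ^ DIM((real^'d)^'m) * exp (- (norm (?L I J))\<^sup>2 / (2 * 1))))"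
    by (intro has_bochner_integral_sum has_bochner_integral_scaleR_right gaussian_fourier) simp
  also have "(\<lambda>a. \<Sum>I\<in>words n. \<Sum>J\<in>words n. (weight I * weight J) *\<^sub>R
          (cis (?L I J \<bullet> a) * complex_of_real (exp (- 1 * (norm a)\<^sup>2 / 2))))
      = (\<lambda>a. complex_of_real (exp (- (norm a)\<^sup>2 / 2) * (norm (charfun n a \<xi>))\<^sup>2))"
  proof
    fix a :: "(real^'d)^'m"
    have "?L I J \<bullet> a = \<xi> \<bullet> point I a - \<xi> \<bullet> point J a" for I J
      using adjoint_works[OF linear_point_diff, of a I J \<xi>]
      by (simp add: inner_commute inner_diff_right)
    then have "cis (?L I J \<bullet> a) = cis (\<xi> \<bullet> point I a) * cnj (cis (\<xi> \<bullet> point J a))" for I J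
      by (simp add: cis_cnj cis_mult)
    moreover have product: "charfun n a \<xi> * cnj (charfun n a \<xi>) = (\<Sum>I\<in>words n. \<Sum>J\<in>words n.
        (weight I *\<^sub>R cis (\<xi> \<bullet> point I a)) * (weight J *\<^sub>R cnj (cis (\<xi> \<bullet> point J a))))"
      by (simp add: charfun_def sum_product)
    ultimately have "(\<Sum>I\<in>words n. \<Sum>J\<in>words n. (weight I * weight J) *\<^sub>R
          (cis (?L I J \<bullet> a) * complex_of_real (exp (- 1 * (norm a)\<^sup>2 / 2))))
        = charfun n a \<xi> * cnj (charfun n a \<xi>) * complex_of_real (exp (- 1 * (norm a)\<^sup>2 / 2))"
      by (simp add: product sum_distrib_left scaleR_conv_of_real mult_ac)
    then show "(\<Sum>I\<in>words n. \<Sum>J\<in>words n. (weight I * weight J) *\<^sub>R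
          (cis (?L I J \<bullet> a) * complex_of_real (exp (- 1 * (norm a)\<^sup>2 / 2))))
        = complex_of_real (exp (- (norm a)\<^sup>2 / 2) * (norm (charfun n a \<xi>))\<^sup>2)"
      by (simp add: complex_norm_square[symmetric] mult.commute del: of_real_power)
  qed
  also have "(\<Sum>I\<in>words n. \<Sum>J\<in>words n. (weight I * weight J) *\<^sub>R
          complex_of_real (sqrt (2 * pi / 1) ^ DIM((real^'d)^'m) * exp (- (norm (?L I J))\<^sup>2 / (2 * 1))))
      = complex_of_real (sqrt (2 * pi) ^ DIM((real^'d)^'m) * pair_energy n \<xi>)"
    by (simp add: pair_energy_def overlap_def sum_distrib_left scaleR_conv_of_real mult_ac)
  finally show ?thesis
    by (simp only: has_bochner_integral_iff complex_of_real_integrable_eq integral_complex_of_real of_real_eq_iff)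
qed

lemma borel_measurable_limit_charfun_fixed [measurable]:
  "(\<lambda>a. limit_charfun a \<xi>) \<in> borel_measurable borel" "limit_charfun a \<in> borel_measurable borel"
  using measurable_Pair1[OF borel_measurable_limit_charfun, of \<xi>]
    measurable_Pair2[OF borel_measurable_limit_charfun, of a] by simp_all

text \<open>
  Fatou's lemma. The contribution of pairs of equal words tends to 0 as the length grows.
\<close>

lemma gaussian_mean_square_limit_charfun_le:
  assumes q: "(\<Sum>i\<in>UNIV. (p i)\<^sup>2) < 1"
  shows "(\<integral>\<^sup>+a. ennreal (exp (- (norm a)\<^sup>2 / 2) * (norm (limit_charfun a \<xi>))\<^sup>2) \<partial>lborel)
    \<le> ennreal (sqrt (2 * pi) ^ DIM((real^'d)^'m)) * (SUP n. ennreal (energy_bound n \<xi>))"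
proof -
  let ?q = "\<Sum>i\<in>UNIV. (p i)\<^sup>2"
  have q0: "0 \<le> ?q" by (intro sum_nonneg) auto
  have [measurable]: "(\<lambda>a. charfun n a \<xi>) \<in> borel_measurable borel" for n
    using measurable_Pair1[OF borel_measurable_charfun, of \<xi> n] by simp
  have le: "(\<integral>\<^sup>+a. ennreal (exp (- (norm a)\<^sup>2 / 2) * (norm (charfun n a \<xi>))\<^sup>2) \<partial>lborel)
      \<le> ennreal (sqrt (2 * pi) ^ DIM((real^'d)^'m)) * (SUP n. ennreal (energy_bound n \<xi>)) + ennreal (sqrt (2 * pi) ^ DIM((real^'d)^'m) * ?q ^ n)" for n
  proof -
    have "(\<integral>\<^sup>+a. ennreal (exp (- (norm a)\<^sup>2 / 2) * (norm (charfun n a \<xi>))\<^sup>2) \<partial>lborel)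
        = ennreal (sqrt (2 * pi) ^ DIM((real^'d)^'m) * pair_energy n \<xi>)"
      using gaussian_mean_square_charfun[of n \<xi>]
      by (subst nn_integral_eq_integral) (auto simp: has_bochner_integral_iff)
    also have "\<dots> \<le> ennreal (sqrt (2 * pi) ^ DIM((real^'d)^'m) * energy_bound n \<xi> + sqrt (2 * pi) ^ DIM((real^'d)^'m) * ?q ^ n)"
      using pair_energy_le[of n \<xi>] by (intro ennreal_leI) (simp flip: distrib_left)
    also have "\<dots> = ennreal (sqrt (2 * pi) ^ DIM((real^'d)^'m)) * ennreal (energy_bound n \<xi>) + ennreal (sqrt (2 * pi) ^ DIM((real^'d)^'m) * ?q ^ n)"
      using q0 by (simp add: energy_bound_nonneg ennreal_plus ennreal_mult)
    also have "\<dots> \<le> ennreal (sqrt (2 * pi) ^ DIM((real^'d)^'m)) * (SUP n. ennreal (energy_bound n \<xi>)) + ennreal (sqrt (2 * pi) ^ DIM((real^'d)^'m) * ?q ^ n)"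
      by (intro add_right_mono mult_left_mono SUP_upper) auto
    finally show ?thesis .
  qed
  have "(\<integral>\<^sup>+a. ennreal (exp (- (norm a)\<^sup>2 / 2) * (norm (limit_charfun a \<xi>))\<^sup>2) \<partial>lborel)
      = (\<integral>\<^sup>+a. liminf (\<lambda>n. ennreal (exp (- (norm a)\<^sup>2 / 2) * (norm (charfun n a \<xi>))\<^sup>2)) \<partial>lborel)"
    by (intro nn_integral_cong lim_imp_Liminf[symmetric] tendsto_ennrealI tendsto_intros charfun_tendsto) simp
  also have "\<dots> \<le> liminf (\<lambda>n. \<integral>\<^sup>+a. ennreal (exp (- (norm a)\<^sup>2 / 2) * (norm (charfun n a \<xi>))\<^sup>2) \<partial>lborel)"
    by (rule nn_integral_liminf) measurable
  also have "\<dots> \<le> liminf (\<lambda>n. ennreal (sqrt (2 * pi) ^ DIM((real^'d)^'m)) * (SUP n. ennreal (energy_bound n \<xi>)) + ennreal (sqrt (2 * pi) ^ DIM((real^'d)^'m) * ?q ^ n))"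
    by (intro Liminf_mono always_eventually allI le)
  also have "\<dots> = ennreal (sqrt (2 * pi) ^ DIM((real^'d)^'m)) * (SUP n. ennreal (energy_bound n \<xi>)) + ennreal (sqrt (2 * pi) ^ DIM((real^'d)^'m) * 0)"
    using q q0 by (intro lim_imp_Liminf tendsto_add tendsto_ennrealI tendsto_mult tendsto_const LIMSEQ_realpow_zero) auto
  finally show ?thesis by simp
qed

text \<open>
  Each unfolding of \<open>energy_bound\<close> adds the fixed integral \<open>G\<close> and multiplies the previous integral by at
  most the ratio in the last assumption: \<open>\<bar>det (T i)\<bar>\<close> enters through the substitution
  \<open>\<eta> = transpose (T i) *v \<xi>\<close>, and \<open>\<alpha> i powr (- (2 * s))\<close> is the price for replacing the weight at \<open>\<xi>\<close> by
  the weight at \<open>\<eta>\<close>. The partial sums of the resulting geometric series give the bound.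
\<close>

lemma weighted_energy_bound:
  fixes s :: real and \<alpha> :: "'m \<Rightarrow> real"
  assumes s: "0 < s" and det: "\<And>i. det (T i) \<noteq> 0"
    and \<alpha>: "\<And>i. 0 < \<alpha> i" "\<And>i. \<alpha> i \<le> 1" "\<And>i \<xi>. \<alpha> i * norm \<xi> \<le> norm (transpose (T i) *v \<xi>)"
    and \<theta>: "(\<Sum>i\<in>UNIV. (p i)\<^sup>2 / (\<bar>det (T i)\<bar> * \<alpha> i powr (2 * s))) < 1" (is "?\<theta> < 1")
  obtains W where "\<And>n. (\<integral>\<^sup>+\<xi>. ennreal ((1 + (norm \<xi>)\<^sup>2) powr s * energy_bound n \<xi>) \<partial>lborel) \<le> ennreal W"
proof -
  define w where "w = (\<lambda>\<xi>::real^'d. (1 + (norm \<xi>)\<^sup>2) powr s)"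
  have [measurable]: "w \<in> borel_measurable borel" unfolding w_def by measurable
  have w0: "0 \<le> w \<xi>" for \<xi> by (simp add: w_def)
  define G where "G = enn2real (\<integral>\<^sup>+\<xi>. ennreal (w \<xi> * exp (- \<kappa> * (norm \<xi>)\<^sup>2)) \<partial>lborel)"
  have G: "(\<integral>\<^sup>+\<xi>. ennreal (w \<xi> * exp (- \<kappa> * (norm \<xi>)\<^sup>2)) \<partial>lborel) = ennreal G" "0 \<le> G"
    using nn_integral_japanese_bracket_gaussian[OF s \<kappa>_pos, where 'a = "real^'d"]
    by (auto simp: G_def w_def)
  have \<theta>0: "0 \<le> ?\<theta>" by (intro sum_nonneg) auto
  let ?r = "\<lambda>i. (p i)\<^sup>2 / (\<bar>det (T i)\<bar> * \<alpha> i powr (2 * s))"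
  have w_le: "w \<xi> \<le> \<alpha> i powr (- (2 * s)) * w (transpose (T i) *v \<xi>)" for i \<xi>
  proof -
    let ?\<eta> = "transpose (T i) *v \<xi>"
    have "(\<alpha> i)\<^sup>2 * (1 + (norm \<xi>)\<^sup>2) = (\<alpha> i)\<^sup>2 + (\<alpha> i * norm \<xi>)\<^sup>2" by (simp add: algebra_simps power_mult_distrib)
    also have "\<dots> \<le> 1 + (norm ?\<eta>)\<^sup>2"
      using \<alpha>(1)[of i] \<alpha>(2)[of i] \<alpha>(3)[of i \<xi>] by (intro add_mono power_mono power_le_one) auto
    finally have "1 + (norm \<xi>)\<^sup>2 \<le> \<alpha> i powr (- 2) * (1 + (norm ?\<eta>)\<^sup>2)"
      using \<alpha>(1)[of i] by (simp add: powr_minus field_simps)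
    then have "w \<xi> \<le> (\<alpha> i powr (- 2) * (1 + (norm ?\<eta>)\<^sup>2)) powr s"
      unfolding w_def using s by (intro powr_mono2) auto
    also have "\<dots> = \<alpha> i powr (- (2 * s)) * w ?\<eta>"
      using \<alpha>(1)[of i] by (simp add: w_def powr_mult powr_powr)
    finally show ?thesis .
  qed
  have "(\<integral>\<^sup>+\<xi>. ennreal (w \<xi> * energy_bound n \<xi>) \<partial>lborel) \<le> ennreal (G / (1 - ?\<theta>))" for n
  proof (induction n)
    case (Suc n)
    let ?E = "\<lambda>\<xi>. ennreal (w \<xi> * energy_bound n \<xi>)"
    have summand: "(\<integral>\<^sup>+\<xi>. ennreal (w \<xi> * ((p i)\<^sup>2 * energy_bound n (transpose (T i) *v \<xi>))) \<partial>lborel)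
        \<le> ennreal (?r i * (G / (1 - ?\<theta>)))" for i
    proof -
      let ?S = "transpose (T i)"
      have d: "det ?S \<noteq> 0" "\<bar>det ?S\<bar> = \<bar>det (T i)\<bar>" using det by (simp_all add: det_transpose)
      have "ennreal (w \<xi> * ((p i)\<^sup>2 * energy_bound n (?S *v \<xi>)))
          \<le> ennreal ((p i)\<^sup>2 * \<alpha> i powr (- (2 * s))) * ?E (?S *v \<xi>)" for \<xi>
      proof -
        have "w \<xi> * ((p i)\<^sup>2 * energy_bound n (?S *v \<xi>))
            \<le> (\<alpha> i powr (- (2 * s)) * w (?S *v \<xi>)) * ((p i)\<^sup>2 * energy_bound n (?S *v \<xi>))"
          by (intro mult_right_mono w_le mult_nonneg_nonneg energy_bound_nonneg) auto
        then show ?thesis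
          by (simp add: ennreal_mult[symmetric] w0 energy_bound_nonneg mult_ac ennreal_leI)
      qed
      then have "(\<integral>\<^sup>+\<xi>. ennreal (w \<xi> * ((p i)\<^sup>2 * energy_bound n (?S *v \<xi>))) \<partial>lborel)
          \<le> (\<integral>\<^sup>+\<xi>. ennreal ((p i)\<^sup>2 * \<alpha> i powr (- (2 * s))) * ?E (?S *v \<xi>) \<partial>lborel)"
        by (intro nn_integral_mono)
      also have "\<dots> = ennreal ((p i)\<^sup>2 * \<alpha> i powr (- (2 * s))) * (\<integral>\<^sup>+\<xi>. ?E (?S *v \<xi>) \<partial>lborel)"
        by (rule nn_integral_cmult) measurable
      also have "(\<integral>\<^sup>+\<xi>. ?E (?S *v \<xi>) \<partial>lborel) = ennreal (1 / \<bar>det (T i)\<bar>) * (\<integral>\<^sup>+\<xi>. ?E \<xi> \<partial>lborel)"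
      proof -
        have "(\<integral>\<^sup>+\<xi>. ?E \<xi> \<partial>lborel) = ennreal \<bar>det (T i)\<bar> * (\<integral>\<^sup>+\<xi>. ?E (?S *v \<xi>) \<partial>lborel)"
          using nn_integral_lborel_matrix[OF d(1), of ?E] d(2) by simp
        then show ?thesis
          using det[of i] by (simp add: mult.assoc[symmetric] ennreal_mult[symmetric])
      qed
      also have "ennreal ((p i)\<^sup>2 * \<alpha> i powr (- (2 * s))) * (ennreal (1 / \<bar>det (T i)\<bar>) * (\<integral>\<^sup>+\<xi>. ?E \<xi> \<partial>lborel))
          = ennreal (?r i) * (\<integral>\<^sup>+\<xi>. ?E \<xi> \<partial>lborel)"
        by (simp add: mult.assoc[symmetric] ennreal_mult[symmetric] powr_minus field_simps)
      also have "\<dots> \<le> ennreal (?r i) * ennreal (G / (1 - ?\<theta>))"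
        by (intro mult_left_mono Suc) auto
      also have "\<dots> = ennreal (?r i * (G / (1 - ?\<theta>)))"
        using G(2) \<theta> by (intro ennreal_mult[symmetric]) auto
      finally show ?thesis .
    qed
    have "(\<integral>\<^sup>+\<xi>. ennreal (w \<xi> * energy_bound (Suc n) \<xi>) \<partial>lborel)
        = (\<integral>\<^sup>+\<xi>. ennreal (w \<xi> * exp (- \<kappa> * (norm \<xi>)\<^sup>2))
            + (\<Sum>i\<in>UNIV. ennreal (w \<xi> * ((p i)\<^sup>2 * energy_bound n (transpose (T i) *v \<xi>)))) \<partial>lborel)"
      by (intro nn_integral_cong)
         (simp add: w0 energy_bound_nonneg sum_ennreal ennreal_plus[symmetric] sum_nonneg distrib_left sum_distrib_left del: ennreal_plus)
    also have "\<dots> = ennreal G + (\<integral>\<^sup>+\<xi>. (\<Sum>i\<in>UNIV. ennreal (w \<xi> * ((p i)\<^sup>2 * energy_bound n (transpose (T i) *v \<xi>)))) \<partial>lborel)"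
      unfolding G(1)[symmetric] by (rule nn_integral_add) measurable
    also have "(\<integral>\<^sup>+\<xi>. (\<Sum>i\<in>UNIV. ennreal (w \<xi> * ((p i)\<^sup>2 * energy_bound n (transpose (T i) *v \<xi>)))) \<partial>lborel)
        = (\<Sum>i\<in>UNIV. \<integral>\<^sup>+\<xi>. ennreal (w \<xi> * ((p i)\<^sup>2 * energy_bound n (transpose (T i) *v \<xi>))) \<partial>lborel)"
      by (rule nn_integral_sum) measurable
    also have "ennreal G + \<dots> \<le> ennreal G + (\<Sum>i\<in>UNIV. ennreal (?r i * (G / (1 - ?\<theta>))))"
      by (intro add_left_mono sum_mono summand)
    also have "\<dots> = ennreal (G + ?\<theta> * (G / (1 - ?\<theta>)))"
    proof -
      have H: "0 \<le> G / (1 - ?\<theta>)" using G(2) \<theta> by simp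
      then have "(\<Sum>i\<in>UNIV. ennreal (?r i * (G / (1 - ?\<theta>)))) = ennreal (\<Sum>i\<in>UNIV. ?r i * (G / (1 - ?\<theta>)))"
        by (intro sum_ennreal mult_nonneg_nonneg) auto
      then show ?thesis
        unfolding sum_distrib_right[symmetric]
        using ennreal_plus[OF G(2) mult_nonneg_nonneg[OF \<theta>0 H]] by (simp only:)
    qed
    also have "G + ?\<theta> * (G / (1 - ?\<theta>)) = G / (1 - ?\<theta>)"
      using \<theta> by (simp add: field_simps)
    finally show ?case .
  qed simp
  then show ?thesis using that unfolding w_def by blast
qed

text \<open>
  By Tonelli's theorem, the weighted integral of the squared modulus has finite Gaussian mean, so it is
  finite for almost every \<open>a\<close>. The inequality \<open>2 * x \<le> w * x\<^sup>2 + 1 / w\<close> then gives integrability, because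
  \<open>s\<close> exceeds half the dimension and hence the reciprocal weight is integrable.
\<close>

lemma AE_integrable_limit_charfun:
  fixes s :: real and \<alpha> :: "'m \<Rightarrow> real"
  assumes s: "CARD('d) / 2 < s" and det: "\<And>i. det (T i) \<noteq> 0"
    and q: "(\<Sum>i\<in>UNIV. (p i)\<^sup>2) < 1"
    and \<alpha>: "\<And>i. 0 < \<alpha> i" "\<And>i. \<alpha> i \<le> 1" "\<And>i \<xi>. \<alpha> i * norm \<xi> \<le> norm (transpose (T i) *v \<xi>)"
    and \<theta>: "(\<Sum>i\<in>UNIV. (p i)\<^sup>2 / (\<bar>det (T i)\<bar> * \<alpha> i powr (2 * s))) < 1"
  shows "AE a in lborel. integrable lborel (limit_charfun a)"
proof -
  have "0 < s" using s by (meson divide_nonneg_pos le_less_trans of_nat_0_le_iff zero_less_numeral)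
  then obtain W where W: "\<And>n. (\<integral>\<^sup>+\<xi>. ennreal ((1 + (norm \<xi>)\<^sup>2) powr s * energy_bound n \<xi>) \<partial>lborel) \<le> ennreal W"
    using weighted_energy_bound[OF _ det \<alpha> \<theta>] by blast
  define w where "w = (\<lambda>\<xi>::real^'d. (1 + (norm \<xi>)\<^sup>2) powr s)"
  have [measurable]: "w \<in> borel_measurable borel" unfolding w_def by measurable
  have wpos: "0 < w \<xi>" for \<xi>
    using add_pos_nonneg[of 1 "(norm \<xi>)\<^sup>2"] by (simp add: w_def)
  have w_inv: "(\<integral>\<^sup>+\<xi>. ennreal (1 / w \<xi>) \<partial>lborel) < \<infinity>"
  proof -
    have "1 / w \<xi> = (1 + (norm \<xi>)\<^sup>2) powr (- s)" for \<xi>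
      unfolding w_def powr_minus by (rule inverse_eq_divide[symmetric])
    moreover have "DIM(real^'d) / 2 < s" using s by simp
    ultimately show ?thesis using nn_integral_japanese_bracket[of s] by (simp only:)
  qed
  define g where "g = (\<lambda>a::(real^'d)^'m. exp (- (norm a)\<^sup>2 / 2))"
  have [measurable]: "g \<in> borel_measurable borel" unfolding g_def by measurable
  define F where "F = (\<lambda>a. \<integral>\<^sup>+\<xi>. ennreal (w \<xi> * (norm (limit_charfun a \<xi>))\<^sup>2) \<partial>lborel)"
  have "(\<integral>\<^sup>+a. ennreal (g a) * F a \<partial>lborel)
      = (\<integral>\<^sup>+a. \<integral>\<^sup>+\<xi>. ennreal (w \<xi>) * ennreal (g a * (norm (limit_charfun a \<xi>))\<^sup>2) \<partial>lborel \<partial>lborel)"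
    unfolding F_def
  proof (rule nn_integral_cong)
    fix a
    have "ennreal (g a) * (\<integral>\<^sup>+\<xi>. ennreal (w \<xi> * (norm (limit_charfun a \<xi>))\<^sup>2) \<partial>lborel)
        = (\<integral>\<^sup>+\<xi>. ennreal (g a) * ennreal (w \<xi> * (norm (limit_charfun a \<xi>))\<^sup>2) \<partial>lborel)"
      by (rule nn_integral_cmult[symmetric]) measurable
    also have "\<dots> = (\<integral>\<^sup>+\<xi>. ennreal (w \<xi>) * ennreal (g a * (norm (limit_charfun a \<xi>))\<^sup>2) \<partial>lborel)"
      using wpos by (intro nn_integral_cong) (simp add: ennreal_mult[symmetric] g_def less_imp_le mult.left_commute)
    finally show "ennreal (g a) * (\<integral>\<^sup>+\<xi>. ennreal (w \<xi> * (norm (limit_charfun a \<xi>))\<^sup>2) \<partial>lborel)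
        = (\<integral>\<^sup>+\<xi>. ennreal (w \<xi>) * ennreal (g a * (norm (limit_charfun a \<xi>))\<^sup>2) \<partial>lborel)" .
  qed
  also have "\<dots> = (\<integral>\<^sup>+\<xi>. \<integral>\<^sup>+a. ennreal (w \<xi>) * ennreal (g a * (norm (limit_charfun a \<xi>))\<^sup>2) \<partial>lborel \<partial>lborel)"
    by (rule lborel_pair.Fubini'[symmetric]) measurable
  also have "\<dots> \<le> (\<integral>\<^sup>+\<xi>. ennreal (w \<xi>) * (ennreal (sqrt (2 * pi) ^ DIM((real^'d)^'m)) * (SUP n. ennreal (energy_bound n \<xi>))) \<partial>lborel)"
  proof (rule nn_integral_mono)
    fix \<xi>
    show "(\<integral>\<^sup>+a. ennreal (w \<xi>) * ennreal (g a * (norm (limit_charfun a \<xi>))\<^sup>2) \<partial>lborel)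
        \<le> ennreal (w \<xi>) * (ennreal (sqrt (2 * pi) ^ DIM((real^'d)^'m)) * (SUP n. ennreal (energy_bound n \<xi>)))"
      using gaussian_mean_square_limit_charfun_le[OF q, of \<xi>]
      by (subst nn_integral_cmult) (auto simp: g_def intro!: mult_left_mono)
  qed
  also have "\<dots> = ennreal (sqrt (2 * pi) ^ DIM((real^'d)^'m)) * (\<integral>\<^sup>+\<xi>. (SUP n. ennreal (w \<xi> * energy_bound n \<xi>)) \<partial>lborel)"
  proof (subst nn_integral_cmult[symmetric])
    have "ennreal (w \<xi>) * (SUP n. ennreal (energy_bound n \<xi>)) = (SUP n. ennreal (w \<xi> * energy_bound n \<xi>))" for \<xi>
      using wpos by (simp add: SUP_mult_left_ennreal ennreal_mult less_imp_le energy_bound_nonneg)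
    then show "(\<integral>\<^sup>+\<xi>. ennreal (w \<xi>) * (ennreal (sqrt (2 * pi) ^ DIM((real^'d)^'m)) * (SUP n. ennreal (energy_bound n \<xi>))) \<partial>lborel)
        = (\<integral>\<^sup>+\<xi>. ennreal (sqrt (2 * pi) ^ DIM((real^'d)^'m)) * (SUP n. ennreal (w \<xi> * energy_bound n \<xi>)) \<partial>lborel)"
      by (intro nn_integral_cong) (metis mult.left_commute)
  qed measurable
  also have "(\<integral>\<^sup>+\<xi>. (SUP n. ennreal (w \<xi> * energy_bound n \<xi>)) \<partial>lborel)
      = (SUP n. \<integral>\<^sup>+\<xi>. ennreal (w \<xi> * energy_bound n \<xi>) \<partial>lborel)"
    by (rule nn_integral_monotone_convergence_SUP)
       (auto intro!: incseq_SucI le_funI ennreal_leI mult_left_mono energy_bound_mono simp: wpos less_imp_le simp del: energy_bound.simps)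
  also have "ennreal (sqrt (2 * pi) ^ DIM((real^'d)^'m)) * \<dots> \<le> ennreal (sqrt (2 * pi) ^ DIM((real^'d)^'m)) * ennreal W"
    using W unfolding w_def by (intro mult_left_mono SUP_least) auto
  also have "\<dots> < \<infinity>" by (simp add: ennreal_mult_less_top)
  finally have fin: "(\<integral>\<^sup>+a. ennreal (g a) * F a \<partial>lborel) \<noteq> \<infinity>" by simp
  have "(\<lambda>a. ennreal (g a) * F a) \<in> borel_measurable lborel"
    unfolding F_def by measurable
  from nn_integral_PInf_AE[OF this fin]
  have "AE a in lborel. ennreal (g a) * F a \<noteq> \<infinity>" .
  then show ?thesis
  proof eventually_elim
    fix a assume "ennreal (g a) * F a \<noteq> \<infinity>"
    then have Fa: "F a < \<infinity>"
      by (auto simp: ennreal_mult_eq_top_iff g_def less_top[symmetric])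
    have "(\<integral>\<^sup>+\<xi>. ennreal (norm (limit_charfun a \<xi>)) \<partial>lborel)
        \<le> (\<integral>\<^sup>+\<xi>. ennreal (w \<xi> * (norm (limit_charfun a \<xi>))\<^sup>2) + ennreal (1 / w \<xi>) \<partial>lborel)"
    proof (rule nn_integral_mono)
      fix \<xi>
      let ?x = "norm (limit_charfun a \<xi>)"
      have "0 \<le> (w \<xi> * ?x - 1)\<^sup>2 / w \<xi>" using wpos[of \<xi>] by simp
      also have "\<dots> = w \<xi> * ?x\<^sup>2 + 1 / w \<xi> - 2 * ?x"
        using wpos[of \<xi>] by (simp add: power2_eq_square field_simps)
      finally have "?x \<le> w \<xi> * ?x\<^sup>2 + 1 / w \<xi>" by (smt (verit) norm_ge_zero)
      then show "ennreal ?x \<le> ennreal (w \<xi> * ?x\<^sup>2) + ennreal (1 / w \<xi>)"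
        using wpos[of \<xi>] by (simp add: ennreal_plus[symmetric] ennreal_leI del: ennreal_plus)
    qed
    also have "\<dots> = F a + (\<integral>\<^sup>+\<xi>. ennreal (1 / w \<xi>) \<partial>lborel)"
      unfolding F_def by (rule nn_integral_add) measurable
    also have "\<dots> < \<infinity>" using Fa w_inv by (simp add: ennreal_add_less_top)
    finally show "integrable lborel (limit_charfun a)"
      by (simp add: integrable_iff_bounded)
  qed
qed

lemma interior_nonempty_if_limit_charfun_integrable:
  assumes int: "integrable lborel (limit_charfun a)"
    and K: "compact K" "K \<noteq> {}" "\<And>i x. x \<in> K \<Longrightarrow> T i *v x + a $ i \<in> K"
  shows "interior K \<noteq> {}"
proof -
  obtain z where "z \<in> K" using K(2) by blast
  show ?thesis
  proof (rule interior_nonempty_if_fourier_integrable[where A = words and P = weight and y = "\<lambda>I. point I a"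
        and R = "2 * norm a" and \<delta> = "\<lambda>n. \<rho> ^ n * norm z" and \<phi> = "limit_charfun a"])
    show "norm (point I a) \<le> 2 * norm a" for I
      by (rule norm_point_le) (rule Finite_Cartesian_Product.norm_nth_le)
    show "\<exists>y\<in>K. dist (point I a) y \<le> \<rho> ^ n * norm z" if "I \<in> words n" for n I
      using point_near_attractor[OF K(3) \<open>z \<in> K\<close>, of I] that by (simp add: words_def)
    show "(\<lambda>n. \<rho> ^ n * norm z) \<longlonglongrightarrow> 0"
      using \<rho>_nonneg \<rho>_less by (intro tendsto_mult_left_zero LIMSEQ_realpow_zero) auto
    show "(\<lambda>n. \<Sum>I\<in>words n. weight I *\<^sub>R cis (\<xi> \<bullet> point I a)) \<longlonglongrightarrow> limit_charfun a \<xi>" for \<xi>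
      using charfun_tendsto[of a \<xi>] by (simp add: charfun_def)
  qed (auto simp: K compact_imp_closed weight_nonneg sum_weight int)
qed

end

section \<open>Non-empty interior for almost every translation vector\<close>

text \<open>
  Strict inequality persists when the exponent is slightly increased.
\<close>

lemma exists_exponent_above:
  fixes \<alpha> D :: "'m::finite \<Rightarrow> real" and d :: nat
  assumes "\<And>i. 0 < \<alpha> i" "1 < (\<Sum>i\<in>UNIV. \<alpha> i ^ d * D i)"
  obtains s where "d / 2 < s" "1 < (\<Sum>i\<in>UNIV. D i * \<alpha> i powr (2 * s))"
proof -
  have "((\<lambda>s. \<Sum>i\<in>UNIV. D i * \<alpha> i powr (2 * s)) \<longlongrightarrow> (\<Sum>i\<in>UNIV. D i * \<alpha> i powr (2 * (d / 2)))) (at_right (d / 2))"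
    using assms(1) by (intro tendsto_intros) (auto simp: less_imp_neq[symmetric])
  moreover have "1 < (\<Sum>i\<in>UNIV. D i * \<alpha> i powr (2 * (d / 2)))"
    using assms by (simp add: powr_realpow mult.commute)
  ultimately have "\<forall>\<^sub>F s in at_right (d / 2). 1 < (\<Sum>i\<in>UNIV. D i * \<alpha> i powr (2 * s))"
    by (rule order_tendstoD)
  moreover have "\<forall>\<^sub>F s in at_right (d / 2). d / 2 < s"
    by (rule eventually_at_right_less)
  ultimately have "\<forall>\<^sub>F s in at_right (d / 2). d / 2 < s \<and> 1 < (\<Sum>i\<in>UNIV. D i * \<alpha> i powr (2 * s))"
    by eventually_elim simp
  from eventually_happens[OF this] show ?thesis
    using that by (auto simp: trivial_limit_at_right_real)
qed

theorem corollary1p2: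
  fixes T :: "'m::finite \<Rightarrow> real^'d^'d"
  assumes "\<And>i. invertible (T i)"
    and "\<And>i. onorm (\<lambda>x. T i *v x) < 1 / 2"
    and "(\<Sum>i\<in>UNIV. smallest_singular_value (T i) ^ CARD('d) * \<bar>det (T i)\<bar>) > 1
         \<or> ((\<forall>i. \<exists>c Q. orthogonal_matrix Q \<and> T i = c *\<^sub>R Q)
            \<and> (\<Sum>i\<in>UNIV. \<bar>det (T i)\<bar>\<^sup>2) > 1)"
  shows "AE a in (lebesgue :: ((real^'d)^'m) measure). interior (self_affine_set T a) \<noteq> {}"
proof -
  define \<alpha> where "\<alpha> = (\<lambda>i. smallest_singular_value (T i))"
  define \<rho> where "\<rho> = Max (range (\<lambda>i. onorm (\<lambda>x. T i *v x)))"
  have onorm_le: "onorm (\<lambda>x. T i *v x) \<le> \<rho>" for i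
    unfolding \<rho>_def by (intro Max_ge) auto
  have "\<rho> \<in> range (\<lambda>i. onorm (\<lambda>x. T i *v x))"
    unfolding \<rho>_def by (intro Max_in) auto
  then have \<rho>: "\<rho> < 1 / 2" using assms(2) by auto
  have \<rho>0: "0 \<le> \<rho>"
    using onorm_pos_le[OF matrix_vector_mul_bounded_linear] onorm_le order_trans by blast
  have T_le: "norm (T i *v x) \<le> \<rho> * norm x" for i x
    using onorm[OF matrix_vector_mul_bounded_linear, of "T i" x] onorm_le[of i]
    by (meson mult_right_mono norm_ge_zero order_trans)
  have nonexp: "norm (T i *v x) \<le> norm x" for i x
    using T_le[of i x] mult_right_mono[of \<rho> 1 "norm x"] \<rho> by simp
  have det: "det (T i) \<noteq> 0" for i using assms(1) invertible_det_nz by blast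
  have \<alpha>_pos: "0 < \<alpha> i" for i unfolding \<alpha>_def by (rule smallest_singular_value_pos[OF assms(1)])
  have \<alpha>_le: "\<alpha> i \<le> 1" for i
    using smallest_singular_value_le_onorm[of "T i"] assms(2)[of i] by (simp add: \<alpha>_def)
  have \<alpha>_transpose: "\<alpha> i * norm \<xi> \<le> norm (transpose (T i) *v \<xi>)" for i \<xi>
    unfolding \<alpha>_def by (rule smallest_singular_value_le_transpose[OF assms(1)])
  have "\<alpha> i ^ CARD('d) * \<bar>det (T i)\<bar> = \<bar>det (T i)\<bar>\<^sup>2" if "orthogonal_matrix Q" "T i = c *\<^sub>R Q" for i c Q
    using that by (simp add: \<alpha>_def smallest_singular_value_conformal abs_det_conformal power2_eq_square del: power2_abs)
  then have "1 < (\<Sum>i\<in>UNIV. \<alpha> i ^ CARD('d) * \<bar>det (T i)\<bar>)"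
    using assms(3) unfolding \<alpha>_def by (metis (no_types, lifting) sum.cong)
  then obtain s where s: "CARD('d) / 2 < s" "1 < (\<Sum>i\<in>UNIV. \<bar>det (T i)\<bar> * \<alpha> i powr (2 * s))"
    using exists_exponent_above[of \<alpha> "CARD('d)" "\<lambda>i. \<bar>det (T i)\<bar>"] \<alpha>_pos by blast
  have "0 < s" using s(1) by (meson divide_nonneg_pos le_less_trans of_nat_0_le_iff zero_less_numeral)
  \<comment> \<open>Weights proportional to \<open>w i\<close> minimise the sum of the \<open>(p i)\<^sup>2 / w i\<close>.\<close>
  define w where "w = (\<lambda>i. \<bar>det (T i)\<bar> * \<alpha> i powr (2 * s))"
  define S where "S = (\<Sum>i\<in>UNIV. w i)"
  have S: "1 < S" using s(2) by (simp add: S_def w_def)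
  have w_pos: "0 < w i" for i using det[of i] \<alpha>_pos[of i] by (simp add: w_def)
  have w_le: "w i \<le> 1" for i
    unfolding w_def using abs_det_le_one_if_nonexpansive[of "T i", OF nonexp] \<alpha>_pos[of i] \<alpha>_le[of i] \<open>0 < s\<close>
    by (intro mult_le_one powr_le1) auto
  define p where "p = (\<lambda>i. w i / S)"
  have "(\<Sum>i\<in>UNIV. (p i)\<^sup>2 / w i) = (\<Sum>i\<in>UNIV. w i) / S\<^sup>2"
    unfolding sum_divide_distrib using w_pos by (intro sum.cong) (auto simp: p_def power2_eq_square less_imp_neq[symmetric])
  also have "\<dots> = 1 / S" using S by (simp add: S_def[symmetric] power2_eq_square)
  finally have \<theta>: "(\<Sum>i\<in>UNIV. (p i)\<^sup>2 / w i) < 1" using S by simp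
  \<comment> \<open>As \<open>w i \<le> 1\<close>, the sum of the squares is below 1 too, so pairs of equal words have no weight in the limit.\<close>
  have "(\<Sum>i\<in>UNIV. (p i)\<^sup>2) \<le> (\<Sum>i\<in>UNIV. (p i)\<^sup>2 / w i)"
  proof (rule sum_mono)
    fix i
    show "(p i)\<^sup>2 \<le> (p i)\<^sup>2 / w i"
      using w_pos[of i] w_le[of i] by (simp add: le_divide_eq mult_left_le)
  qed
  with \<theta> have q: "(\<Sum>i\<in>UNIV. (p i)\<^sup>2) < 1" by simp
  interpret weighted_affine_ifs T p \<rho>
  proof
    show "(\<Sum>i\<in>UNIV. p i) = 1" using S by (simp add: p_def sum_divide_distrib[symmetric] S_def[symmetric])
    show "0 \<le> p i" for i using w_pos[of i] S by (simp add: p_def)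
  qed (use T_le \<rho> \<rho>0 in auto)
  have "AE a in lborel. integrable lborel (limit_charfun a)"
    using s(1) det q \<alpha>_pos \<alpha>_le \<alpha>_transpose \<theta>[unfolded w_def] by (rule AE_integrable_limit_charfun)
  then have "AE a in lborel. interior (self_affine_set T a) \<noteq> {}"
  proof eventually_elim
    fix a :: "(real^'d)^'m"
    assume "integrable lborel (limit_charfun a)"
    moreover have "T i *v x + a $ i \<in> self_affine_set T a" if "x \<in> self_affine_set T a" for i x
      using self_affine_set_attractor(3)[of T \<rho> a] T_le \<rho>0 \<rho> that by fastforce
    ultimately show "interior (self_affine_set T a) \<noteq> {}"
      using self_affine_set_attractor(1,2)[of T \<rho> a] T_le \<rho>0 \<rho>
      by (intro interior_nonempty_if_limit_charfun_integrable) auto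
  qed
  then show ?thesis by (rule AE_completion)
qed

end
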